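(* Let $(X_0,\tau_0)$ be a complete Hausdorff locally convex space whose topology is given by a system $(p_{\gamma,0})_{\gamma\in\Gamma}$ of seminorms, and let $T_0=(T_0(t))_{t\geqslant 0}$ be a strongly continuous and exponentially equicontinuous semigroup on $X_0$ whose generator $A_0\colon D(A_0)\to X_0$ is bijective with continuous inverse $A_0^{-1}\colon X_0\to X_0$. Let $(X_n,\tau_n)$, $T_n=(T_n(t))_{t\geqslant 0}$, $A_n$ ($n\in\mathbb{Z}$) be the associated Sobolev tower (defined recursively in the context). Then the spaces $(X_n,\tau_n)$, $n\in\mathbb{Z}$, are well-defined complete locally convex spaces with the following properties. (i) For every $n\in\mathbb{Z}$, $X_n\subseteq X_{n-1}$, $X_n$ is dense in $(X_{n-1},\tau_{n-1})$, and the inclusion map $(X_n,\tau_n)\hookrightarrow(X_{n-1},\tau_{n-1})$ is continuous. (ii) For $n\leqslant 0$ the topology $\tau_n$ is given by the seminorms $(p_{\gamma,n-1}(A_{n-1}(\cdot)))_{\gamma\in\Gamma}$. (iii) For $n\geqslant 0$ the space $(X_n,\tau_n)$ is the completion of $(X_{n+1},\check\tau_n)$, where $\check\tau_n$ is given by the seminorms $\check p_{\gamma,n}(\cdot)=p_{\gamma,n+1}(A_{n+1}^{-1}(\cdot))$, $\gamma\in\Gamma$. Moreover, the families $T_n=(T_n(t))_{t\geqslant 0}$, $n\in\mathbb{Z}$, define strongly continuous and exponentially equicontinuous semigroups on the spaces $(X_n,\tau_n)$ with the following properties. (iv) For every $n\in\mathbb{Z}$ and $t\geqslant 0$, $T_n(t)\colon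 X_n\to X_n$ is the restriction of $T_{n-1}(t)\colon X_{n-1}\to X_{n-1}$ and the unique continuous extension (with respect to $\tau_n$) of $T_{n+1}(t)\colon X_{n+1}\to X_{n+1}$. (v) For every $n\in\mathbb{Z}$, $D(A_n)=X_{n+1}$ and the generator $A_n\colon(X_{n+1},\tau_{n+1})\to(X_n,\tau_n)$ is an isomorphism (linear homeomorphism). It is the restriction of $A_{n-1}\colon X_n\to X_{n-1}$ and the unique continuous extension of $A_{n+1}\colon X_{n+2}\to X_{n+1}$.
   Context: A strongly continuous and exponentially equicontinuous semigroup on a locally convex space $Y$ is a map $T\colon[0,\infty)\to L(Y)$ (continuous linear operators on $Y$) such that $T(t+s)=T(t)T(s)$ for $s,t\geqslant 0$, $T(0)=I$, $t\mapsto T(t)x$ is continuous for every $x\in Y$, and there is $\omega\in\mathbb{R}$ such that $\{e^{\omega t}T(t) : t\geqslant 0\}\subseteq L(Y)$ is equicontinuous. Its generator $(A,D(A))$ is $Ax=\lim_{t\searrow 0}\frac{T(t)x-x}{t}$ with $D(A)$ the set of all $x\in Y$ for which this limit exists. Sobolev tower, defined recursively from $(X_0,\tau_0)$, $T_0$, $A_0$: For $n\geqslant 1$: $X_n=D(A_{n-1})$, with topology $\tau_n$ given by the seminorms $p_{\gamma,n}(x)=p_{\gamma,n-1}(A_{n-1}x)$ for $x\in X_n$, $\gamma\in\Gamma$. For $t\geqslant 0$, $T_n(t)=T_{n-1}(t)|_{X_n}\colon X_n\to X_n$; $T_n=(T_n(t))_{t\geqslant 0}$, and $(A_n,D(A_n))$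 is the generator of $T_n$. For $n\leqslant -1$: let $\check\tau_n$ be the topology on $X_{n+1}$ given by the seminorms $\check p_{\gamma,n}(x)=p_{\gamma,n+1}(A_{n+1}^{-1}x)$ for $x\in X_{n+1}$, $\gamma\in\Gamma$, and let $(X_n,\tau_n)$ be the completion of $(X_{n+1},\check\tau_n)$, with $p_{\gamma,n}$ the continuous extension of $\check p_{\gamma,n}$; $X_{n+1}$ is regarded as a subspace of $X_n$. For $t\geqslant 0$, $T_n(t)\colon(X_n,\tau_n)\to(X_n,\tau_n)$ is the unique continuous extension of $T_{n+1}(t)\colon X_{n+1}\to X_{n+1}$; $T_n=(T_n(t))_{t\geqslant 0}$, and $(A_n,D(A_n))$ is the generator of $T_n$. That these recursive definitions make sense at each step (in particular that the restrictions and extensions exist, and that $A_{n}\colon D(A_n)\to X_n$ is bijective) is part of what "well-defined" asserts. *)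

theory Defs
  imports "HOL-Analysis.Analysis" "HOL-Library.Poly_Mapping"
begin

(* Vector spaces are subspaces X of an ambient type with scalar multiplication
   "smul :: 'k => 'a => 'a" (locale vector_space).  A real_normed_field is isomorphic to
   the reals or the complex numbers (Gelfand-Mazur), so the scalars 'k :: real_normed_field
   cover exactly the real and the complex case. *)

definition linear_map_on ::
  "('k::field \<Rightarrow> 'a::ab_group_add \<Rightarrow> 'a) \<Rightarrow> ('k \<Rightarrow> 'b::ab_group_add \<Rightarrow> 'b) \<Rightarrow> 'a set \<Rightarrow> ('a \<Rightarrow> 'b) \<Rightarrow> bool" where
  "linear_map_on smul smul2 X f \<longleftrightarrow>
     (\<forall>x\<in>X. \<forall>y\<in>X. f (x + y) = f x + f y) \<and>
     (\<forall>c. \<forall>x\<in>X. f (smul c x) = smul2 c (f x))"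

definition seminorm_on ::
  "('k::real_normed_field \<Rightarrow> 'a::ab_group_add \<Rightarrow> 'a) \<Rightarrow> 'a set \<Rightarrow> ('a \<Rightarrow> real) \<Rightarrow> bool" where
  "seminorm_on smul X q \<longleftrightarrow>
     (\<forall>x\<in>X. 0 \<le> q x) \<and>
     (\<forall>x\<in>X. \<forall>y\<in>X. q (x + y) \<le> q x + q y) \<and>
     (\<forall>c. \<forall>x\<in>X. q (smul c x) = norm c * q x)"

(* The family P of seminorms need not be directed, hence the finite subsets. *)
definition seminorm_topology :: "'a::ab_group_add set \<Rightarrow> ('a \<Rightarrow> real) set \<Rightarrow> 'a topology" where
  "seminorm_topology X P = topology (\<lambda>U. U \<subseteq> X \<and>
     (\<forall>x\<in>U. \<exists>F \<epsilon>. finite F \<and> F \<subseteq> P \<and> 0 < \<epsilon> \<and> {y\<in>X. \<forall>q\<in>F. q (y - x) < \<epsilon>} \<subseteq> U))"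

lemma openin_seminorm_topology:
  "openin (seminorm_topology X P) U \<longleftrightarrow> U \<subseteq> X \<and>
     (\<forall>x\<in>U. \<exists>F \<epsilon>. finite F \<and> F \<subseteq> P \<and> 0 < \<epsilon> \<and> {y\<in>X. \<forall>q\<in>F. q (y - x) < \<epsilon>} \<subseteq> U)"
proof -
  let ?B = "\<lambda>x F \<epsilon>. {y\<in>X. \<forall>q\<in>F. q (y - x) < (\<epsilon>::real)}"
  let ?N = "\<lambda>U x. \<exists>F \<epsilon>. finite F \<and> F \<subseteq> P \<and> 0 < \<epsilon> \<and> ?B x F \<epsilon> \<subseteq> U"
  have "istopology (\<lambda>U. U \<subseteq> X \<and> (\<forall>x\<in>U. ?N U x))"
    unfolding istopology_def
  proof (intro conjI allI impI)
    fix S T assume S: "S \<subseteq> X \<and> (\<forall>x\<in>S. ?N S x)" and T: "T \<subseteq> X \<and> (\<forall>x\<in>T. ?N T x)"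
    show "S \<inter> T \<subseteq> X" using S by blast
    show "\<forall>x\<in>S \<inter> T. ?N (S \<inter> T) x"
    proof
      fix x assume "x \<in> S \<inter> T"
      then have "?N S x" "?N T x" using S T by blast+
      then obtain F \<epsilon> G \<delta> where
        "finite F" "F \<subseteq> P" "0 < \<epsilon>" "?B x F \<epsilon> \<subseteq> S" "finite G" "G \<subseteq> P" "0 < \<delta>" "?B x G \<delta> \<subseteq> T"
        by (elim exE conjE) blast
      moreover from this have "?B x (F \<union> G) (min \<epsilon> \<delta>) \<subseteq> S \<inter> T" by fastforce
      ultimately show "?N (S \<inter> T) x"
        by (intro exI[of _ "F \<union> G"] exI[of _ "min \<epsilon> \<delta>"]) simp
    qed
  next
    fix \<K> assume K: "\<forall>K\<in>\<K>. K \<subseteq> X \<and> (\<forall>x\<in>K. ?N K x)"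
    show "\<Union>\<K> \<subseteq> X" using K by blast
    show "\<forall>x\<in>\<Union>\<K>. ?N (\<Union>\<K>) x"
    proof
      fix x assume "x \<in> \<Union>\<K>"
      then obtain K where "K \<in> \<K>" "x \<in> K" by blast
      then have "?N K x" "K \<subseteq> \<Union>\<K>" using K by blast+
      then show "?N (\<Union>\<K>) x" by (elim exE conjE) (intro exI conjI, assumption+, rule order_trans)
    qed
  qed
  then show ?thesis unfolding seminorm_topology_def by (simp add: topology_inverse')
qed

lemma topspace_seminorm_topology [simp]: "topspace (seminorm_topology X P) = X"
proof -
  have "openin (seminorm_topology X P) X"
    unfolding openin_seminorm_topology by (auto intro!: exI[of _ "{}"] exI[of _ 1])
  then have "X \<subseteq> topspace (seminorm_topology X P)" by (rule openin_subset)
  moreover have "topspace (seminorm_topology X P) \<subseteq> X"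
    using openin_topspace[of "seminorm_topology X P"] unfolding openin_seminorm_topology by (rule conjunct1)
  ultimately show ?thesis by (rule equalityI[rotated])
qed

definition locally_convex_space ::
  "('k::real_normed_field \<Rightarrow> 'a::ab_group_add \<Rightarrow> 'a) \<Rightarrow> 'a set \<Rightarrow> 'a topology \<Rightarrow> bool" where
  "locally_convex_space smul X \<tau> \<longleftrightarrow> module.subspace smul X \<and>
     (\<exists>P. (\<forall>q\<in>P. seminorm_on smul X q) \<and> \<tau> = seminorm_topology X P)"

(* Completeness for the translation-invariant uniformity: Cauchy filters on X converge. *)
definition complete_tvs :: "'a::ab_group_add set \<Rightarrow> 'a topology \<Rightarrow> bool" where
  "complete_tvs X \<tau> \<longleftrightarrow>
     (\<forall>F. F \<noteq> bot \<and> (\<forall>\<^sub>F x in F. x \<in> X) \<and>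
        (\<forall>U. openin \<tau> U \<and> 0 \<in> U \<longrightarrow>
           (\<exists>S. (\<forall>\<^sub>F x in F. x \<in> S) \<and> (\<forall>x\<in>S. \<forall>y\<in>S. x - y \<in> U)))
        \<longrightarrow> (\<exists>l. limitin \<tau> (\<lambda>x. x) l F))"

(* (X, \<tau>) is a completion of (Y, \<sigma>), with Y regarded as a subspace of X. *)
definition is_completion ::
  "('k::real_normed_field \<Rightarrow> 'a::ab_group_add \<Rightarrow> 'a) \<Rightarrow> 'a set \<Rightarrow> 'a topology \<Rightarrow> 'a set \<Rightarrow> 'a topology \<Rightarrow> bool" where
  "is_completion smul Y \<sigma> X \<tau> \<longleftrightarrow>
     locally_convex_space smul X \<tau> \<and> Hausdorff_space \<tau> \<and> complete_tvs X \<tau> \<and>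
     Y \<subseteq> X \<and> subtopology \<tau> Y = \<sigma> \<and> \<tau> closure_of Y = X"

definition unique_continuous_extension ::
  "'a topology \<Rightarrow> 'b topology \<Rightarrow> 'a set \<Rightarrow> ('a \<Rightarrow> 'b) \<Rightarrow> ('a \<Rightarrow> 'b) \<Rightarrow> bool" where
  "unique_continuous_extension \<tau> \<sigma> Y f g \<longleftrightarrow>
     continuous_map \<tau> \<sigma> g \<and> (\<forall>y\<in>Y. g y = f y) \<and>
     (\<forall>h. continuous_map \<tau> \<sigma> h \<and> (\<forall>y\<in>Y. h y = f y) \<longrightarrow> (\<forall>x\<in>topspace \<tau>. h x = g x))"

(* Only the values on topspace \<tau> are meaningful; extensional makes the description definite. *)
definition continuous_extension ::
  "'a topology \<Rightarrow> 'b topology \<Rightarrow> 'a set \<Rightarrow> ('a \<Rightarrow> 'b) \<Rightarrow> 'a \<Rightarrow> 'b" where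
  "continuous_extension \<tau> \<sigma> Y f =
     (THE g. g \<in> extensional (topspace \<tau>) \<and> continuous_map \<tau> \<sigma> g \<and> (\<forall>y\<in>Y. g y = f y))"

definition equicontinuous_on :: "'a::ab_group_add set \<Rightarrow> 'a topology \<Rightarrow> ('a \<Rightarrow> 'a) set \<Rightarrow> bool" where
  "equicontinuous_on X \<tau> H \<longleftrightarrow>
     (\<forall>x\<in>X. \<forall>U. openin \<tau> U \<and> 0 \<in> U \<longrightarrow>
        (\<exists>V. openin \<tau> V \<and> 0 \<in> V \<and> (\<forall>S\<in>H. \<forall>y\<in>X. y - x \<in> V \<longrightarrow> S y - S x \<in> U)))"

(* Strongly continuous, exponentially equicontinuous semigroup; T t is only relevant for t \<ge> 0. *)
definition sc_ee_semigroup ::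
  "('k::real_normed_field \<Rightarrow> 'a::ab_group_add \<Rightarrow> 'a) \<Rightarrow> 'a set \<Rightarrow> 'a topology \<Rightarrow> (real \<Rightarrow> 'a \<Rightarrow> 'a) \<Rightarrow> bool" where
  "sc_ee_semigroup smul X \<tau> T \<longleftrightarrow>
     (\<forall>t\<ge>0. linear_map_on smul smul X (T t) \<and> continuous_map \<tau> \<tau> (T t)) \<and>
     (\<forall>t\<ge>0. \<forall>s\<ge>0. \<forall>x\<in>X. T (t + s) x = T t (T s x)) \<and>
     (\<forall>x\<in>X. T 0 x = x) \<and>
     (\<forall>x\<in>X. continuous_map (top_of_set {0..}) \<tau> (\<lambda>t. T t x)) \<and>
     (\<exists>\<omega>::real. equicontinuous_on X \<tau> {\<lambda>x. smul (of_real (exp (\<omega> * t))) (T t x) | t. 0 \<le> t})"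

definition generator_domain ::
  "('k::real_normed_field \<Rightarrow> 'a::ab_group_add \<Rightarrow> 'a) \<Rightarrow> 'a set \<Rightarrow> 'a topology \<Rightarrow> (real \<Rightarrow> 'a \<Rightarrow> 'a) \<Rightarrow> 'a set" where
  "generator_domain smul X \<tau> T =
     {x\<in>X. \<exists>y. limitin \<tau> (\<lambda>t. smul (of_real (1 / t)) (T t x - x)) y (at_right 0)}"

definition generator ::
  "('k::real_normed_field \<Rightarrow> 'a::ab_group_add \<Rightarrow> 'a) \<Rightarrow> 'a topology \<Rightarrow> (real \<Rightarrow> 'a \<Rightarrow> 'a) \<Rightarrow> 'a \<Rightarrow> 'a" where
  "generator smul \<tau> T x =
     (THE y. limitin \<tau> (\<lambda>t. smul (of_real (1 / t)) (T t x - x)) y (at_right 0))"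

(* A realization of the Sobolev tower of (X0, \<tau>0), (p0 \<gamma>)\<^bsub>\<gamma> \<in> \<Gamma>\<^esub>, T0 inside an ambient
   vector space 'b that leaves room for the successive completions; j identifies X0 with X 0.
   A large enough choice of 'b is the free vector space over nat * 'a, since every X n with
   n < 0 is in bijection with X0.
   All objects other than the completions are given by explicit formulas or definite
   descriptions, so the definition does not presuppose that restrictions map X n into X n,
   that extensions exist, or that generators are bijective. *)
definition sobolev_tower ::
  "('k::real_normed_field \<Rightarrow> 'a::ab_group_add \<Rightarrow> 'a) \<Rightarrow> 'a set \<Rightarrow> 'a topology \<Rightarrow> 'g set \<Rightarrow>
   ('g \<Rightarrow> 'a \<Rightarrow> real) \<Rightarrow> (real \<Rightarrow> 'a \<Rightarrow> 'a) \<Rightarrow>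
   ('k \<Rightarrow> 'b::ab_group_add \<Rightarrow> 'b) \<Rightarrow> ('a \<Rightarrow> 'b) \<Rightarrow>
   (int \<Rightarrow> 'b set) \<Rightarrow> (int \<Rightarrow> 'b topology) \<Rightarrow> (int \<Rightarrow> 'g \<Rightarrow> 'b \<Rightarrow> real) \<Rightarrow>
   (int \<Rightarrow> real \<Rightarrow> 'b \<Rightarrow> 'b) \<Rightarrow> (int \<Rightarrow> 'b set) \<Rightarrow> (int \<Rightarrow> 'b \<Rightarrow> 'b) \<Rightarrow> bool" where
  "sobolev_tower smul X0 \<tau>0 \<Gamma> p0 T0 sc j X \<tau> p T D A \<longleftrightarrow>
     vector_space sc \<and>
     (\<forall>n. D n = generator_domain sc (X n) (\<tau> n) (T n) \<and> A n = generator sc (\<tau> n) (T n)) \<and>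
     linear_map_on smul sc X0 j \<and> X 0 = j ` X0 \<and> topspace (\<tau> 0) = X 0 \<and>
     homeomorphic_map \<tau>0 (\<tau> 0) j \<and>
     (\<forall>\<gamma>\<in>\<Gamma>. \<forall>x\<in>X0. p 0 \<gamma> (j x) = p0 \<gamma> x) \<and>
     (\<forall>t\<ge>0. \<forall>x\<in>X0. T 0 t (j x) = j (T0 t x)) \<and>
     (\<forall>n\<ge>1.
        X n = D (n - 1) \<and>
        (\<forall>\<gamma>\<in>\<Gamma>. \<forall>x\<in>X n. p n \<gamma> x = p (n - 1) \<gamma> (A (n - 1) x)) \<and>
        \<tau> n = seminorm_topology (X n) (p n ` \<Gamma>) \<and>
        (\<forall>t\<ge>0. \<forall>x\<in>X n. T n t x = T (n - 1) t x)) \<and>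
     (\<forall>n\<le>-1.
        let q = (\<lambda>\<gamma> x. p (n + 1) \<gamma> (inv_into (D (n + 1)) (A (n + 1)) x)) in
        is_completion sc (X (n + 1)) (seminorm_topology (X (n + 1)) (q ` \<Gamma>)) (X n) (\<tau> n) \<and>
        (\<forall>\<gamma>\<in>\<Gamma>. \<forall>x\<in>X n.
           p n \<gamma> x = continuous_extension (\<tau> n) euclideanreal (X (n + 1)) (q \<gamma>) x) \<and>
        (\<forall>t\<ge>0. \<forall>x\<in>X n.
           T n t x = continuous_extension (\<tau> n) (\<tau> n) (X (n + 1)) (T (n + 1) t) x))"

end

theory Submission
  imports Defs
begin

text \<open>Write \<open>R\<close> for the inverse of a generator \<open>A\<close> with domain \<open>D\<close>. Since \<open>R\<close> commutes with the
  semigroup, \<open>R\<close> is an isometric isomorphism of the level \<open>(X, p, T)\<close> onto the next level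
  \<open>(D, p \<circ> A, T)\<close>, so all its properties are transported along \<open>R\<close>. In the other direction, let
  \<open>Y\<close> be the completion of \<open>X\<close> with respect to the seminorms \<open>p \<circ> R\<close>. The isometries
  \<open>A : D \<rightarrow> X\<close> and \<open>R : X \<rightarrow> D\<close> extend by density to mutually inverse isomorphisms between \<open>X\<close> and
  \<open>Y\<close>, and transport along \<open>X \<rightarrow> Y\<close> shows that the generator on \<open>Y\<close> has domain \<open>X\<close>; hence \<open>X\<close>
  is the level above \<open>Y\<close>. All levels are thus copies of \<open>X\<^sub>0\<close>, and the tower is realised inside the
  direct limit of \<open>X\<^sub>0 \<rightarrow> X\<^sub>0 \<rightarrow> \<dots>\<close> along \<open>R\<close>.\<close>

section \<open>Seminorm topologies\<close>

text \<open>The tower prescribes a lower space only by the property of being a completion, and its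
  seminorms and operators only by definite descriptions. Nothing about such a level can be evaluated
  before it is identified with a copy of the level above, so an arbitrary tower is treated by
  showing that every completion allowed by the definition is such a copy. The comparison works in
  any ambient space. The direct limit answers a different question: a negative step may add new
  points, while all levels must be subsets of one vector space chosen beforehand, and without a
  realisation the statement about all towers could be empty. Seminorms and operators are functions
  on whole types that mean something only on their carrier; hence the care about values on carriers
  throughout.\<close>

locale lcs = vector_space sc for sc :: "'k::real_normed_field \<Rightarrow> 'a::ab_group_add \<Rightarrow> 'a" +
  fixes X :: "'a set" and P :: "('a \<Rightarrow> real) set"
  assumes subspace_X: "subspace X"
    and seminorm_P: "q \<in> P \<Longrightarrow> seminorm_on sc X q"
begin

abbreviation \<tau> where "\<tau> \<equiv> seminorm_topology X P"

lemma seminorm_nonneg: "q \<in> P \<Longrightarrow> x \<in> X \<Longrightarrow> 0 \<le> q x"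
  and seminorm_triangle: "q \<in> P \<Longrightarrow> x \<in> X \<Longrightarrow> y \<in> X \<Longrightarrow> q (x + y) \<le> q x + q y"
  and seminorm_scale: "q \<in> P \<Longrightarrow> x \<in> X \<Longrightarrow> q (sc c x) = norm c * q x"
  using seminorm_P unfolding seminorm_on_def by blast+

lemmas X_closed = subspace_0[OF subspace_X] subspace_add[OF subspace_X] subspace_diff[OF subspace_X]
  subspace_scale[OF subspace_X]

lemma seminorm_zero: "q \<in> P \<Longrightarrow> q 0 = 0"
  using seminorm_scale[of q 0 0] X_closed by simp

lemma seminorm_minus_commute:
  assumes "q \<in> P" "x \<in> X" "y \<in> X" shows "q (x - y) = q (y - x)"
proof -
  have "q (y - x) = q (sc (-1) (x - y))" by simp
  also have "\<dots> = q (x - y)" using assms X_closed by (simp only: seminorm_scale) simp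
  finally show ?thesis by simp
qed

lemma seminorm_diff_triangle:
  assumes "q \<in> P" "x \<in> X" "y \<in> X" "z \<in> X" shows "q (x - z) \<le> q (x - y) + q (y - z)"
  using seminorm_triangle[of q "x - y" "y - z"] assms X_closed by simp

lemma openin_ball:
  assumes "finite F" "F \<subseteq> P" "0 < \<epsilon>" "x \<in> X"
  shows "openin \<tau> {y\<in>X. \<forall>q\<in>F. q (y - x) < \<epsilon>}"
  unfolding openin_seminorm_topology
proof (intro conjI ballI)
  fix y assume "y \<in> {y\<in>X. \<forall>q\<in>F. q (y - x) < \<epsilon>}"
  then have y: "y \<in> X" "\<And>q. q \<in> F \<Longrightarrow> q (y - x) < \<epsilon>" by auto
  \<comment> \<open>The element 1 keeps the minimum defined for empty \<open>F\<close>; otherwise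
    \<delta> is at most the slack that \<open>y\<close> leaves in each inequality.\<close>
  define \<delta> where "\<delta> = Min (insert 1 ((\<lambda>q. \<epsilon> - q (y - x)) ` F))"
  have "0 < \<delta>" unfolding \<delta>_def using assms(1) y(2) by auto
  moreover have "\<delta> \<le> \<epsilon> - q (y - x)" if "q \<in> F" for q
    unfolding \<delta>_def using assms(1) that by simp
  then have "{z\<in>X. \<forall>q\<in>F. q (z - y) < \<delta>} \<subseteq> {y\<in>X. \<forall>q\<in>F. q (y - x) < \<epsilon>}"
    using seminorm_diff_triangle y(1) assms(2,4) by (clarsimp simp: subset_iff) (smt (verit))
  ultimately show "\<exists>F' \<delta>. finite F' \<and> F' \<subseteq> P \<and> 0 < \<delta> \<and>
      {z\<in>X. \<forall>q\<in>F'. q (z - y) < \<delta>} \<subseteq> {y\<in>X. \<forall>q\<in>F. q (y - x) < \<epsilon>}"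
    using assms(1,2) by blast
qed auto

lemma openin_contains_ball:
  assumes "openin \<tau> U" "x \<in> U"
  obtains F \<epsilon> where "finite F" "F \<subseteq> P" "0 < \<epsilon>" "{y\<in>X. \<forall>q\<in>F. q (y - x) < \<epsilon>} \<subseteq> U"
  using assms unfolding openin_seminorm_topology by blast

text \<open>A basic neighbourhood involves finitely many seminorms, and finitely many eventual
  statements can be combined; so one seminorm at a time suffices although \<open>P\<close> need not
  be directed.\<close>

lemma limitin_iff:
  "limitin \<tau> f l F \<longleftrightarrow> l \<in> X \<and> (\<forall>\<^sub>F t in F. f t \<in> X) \<and> (\<forall>q\<in>P. \<forall>\<epsilon>>0. \<forall>\<^sub>F t in F. q (f t - l) < \<epsilon>)"
  (is "?L \<longleftrightarrow> ?R")
proof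
  assume L: ?L
  then have l: "l \<in> X" by (auto dest: limitin_topspace)
  have "\<forall>\<^sub>F t in F. f t \<in> X" using limitinD[OF L, of X] l openin_topspace[of \<tau>] by simp
  moreover have "\<forall>\<^sub>F t in F. q (f t - l) < \<epsilon>" if "q \<in> P" "0 < \<epsilon>" for q \<epsilon>
    using limitinD[OF L openin_ball[of "{q}" \<epsilon> l]] that l
    by (auto simp: seminorm_zero elim: eventually_mono)
  ultimately show ?R using l by blast
next
  assume R: ?R
  show ?L unfolding limitin_def
  proof (intro conjI allI impI)
    fix U assume "openin \<tau> U \<and> l \<in> U"
    then obtain G \<epsilon> where G: "finite G" "G \<subseteq> P" "0 < \<epsilon>" "{y\<in>X. \<forall>q\<in>G. q (y - l) < \<epsilon>} \<subseteq> U"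
      by (auto elim: openin_contains_ball)
    then have "\<forall>\<^sub>F t in F. \<forall>q\<in>G. q (f t - l) < \<epsilon>"
      using R by (subst eventually_ball_finite_distrib) auto
    moreover have "\<forall>\<^sub>F t in F. f t \<in> X" using R by simp
    ultimately show "\<forall>\<^sub>F t in F. f t \<in> U"
      by eventually_elim (use G in auto)
  qed (use R in simp)
qed

lemma limitin_add:
  assumes "limitin \<tau> f l F" "limitin \<tau> g m F"
  shows "limitin \<tau> (\<lambda>t. f t + g t) (l + m) F"
  unfolding limitin_iff
proof (intro conjI ballI allI impI)
  have X: "l \<in> X" "m \<in> X" "\<forall>\<^sub>F t in F. f t \<in> X" "\<forall>\<^sub>F t in F. g t \<in> X"
    using assms by (auto simp: limitin_iff)
  show "l + m \<in> X" using X X_closed by blast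
  show "\<forall>\<^sub>F t in F. f t + g t \<in> X" using X(3,4) by eventually_elim (simp add: X_closed)
  fix q and \<epsilon> :: real assume q: "q \<in> P" "0 < \<epsilon>"
  then have "0 < \<epsilon> / 2" by simp
  with q have "\<forall>\<^sub>F t in F. q (f t - l) < \<epsilon> / 2" "\<forall>\<^sub>F t in F. q (g t - m) < \<epsilon> / 2"
    using assms unfolding limitin_iff by blast+
  with X(3,4) show "\<forall>\<^sub>F t in F. q (f t + g t - (l + m)) < \<epsilon>"
  proof eventually_elim
    case (elim t)
    have "q ((f t - l) + (g t - m)) \<le> q (f t - l) + q (g t - m)"
      using elim X q X_closed by (intro seminorm_triangle) auto
    also have "\<dots> < \<epsilon>" using elim by simp
    finally show ?case by (simp add: algebra_simps)
  qed
qed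

lemma limitin_scale:
  assumes "limitin \<tau> f l F"
  shows "limitin \<tau> (\<lambda>t. sc c (f t)) (sc c l) F"
  unfolding limitin_iff
proof (intro conjI ballI allI impI)
  have X: "l \<in> X" "\<forall>\<^sub>F t in F. f t \<in> X" using assms by (auto simp: limitin_iff)
  show "sc c l \<in> X" using X X_closed by blast
  show "\<forall>\<^sub>F t in F. sc c (f t) \<in> X" using X(2) by eventually_elim (simp add: X_closed)
  fix q and \<epsilon> :: real assume q: "q \<in> P" "0 < \<epsilon>"
  \<comment> \<open>The summand 1 allows division also for \<open>c = 0\<close>.\<close>
  have c: "0 < norm c + 1" by (simp add: add_nonneg_pos)
  with q have "0 < \<epsilon> / (norm c + 1)" by simp
  then have "\<forall>\<^sub>F t in F. q (f t - l) < \<epsilon> / (norm c + 1)"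
    using assms q by (auto simp: limitin_iff)
  with X(2) show "\<forall>\<^sub>F t in F. q (sc c (f t) - sc c l) < \<epsilon>"
  proof eventually_elim
    case (elim t)
    have "q (sc c (f t) - sc c l) = norm c * q (f t - l)"
      using elim X q X_closed by (simp add: seminorm_scale scale_right_diff_distrib[symmetric])
    also have "\<dots> \<le> (norm c + 1) * q (f t - l)"
      using seminorm_nonneg[OF q(1)] elim X X_closed by (intro mult_right_mono) auto
    also have "\<dots> < \<epsilon>" using elim(2) c by (simp add: pos_less_divide_eq mult.commute)
    finally show ?case .
  qed
qed


lemma continuous_map_add:
  assumes "continuous_map \<sigma> \<tau> f" "continuous_map \<sigma> \<tau> g"
  shows "continuous_map \<sigma> \<tau> (\<lambda>x. f x + g x)"
  using assms unfolding continuous_map_atin by (blast intro: limitin_add)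

lemma continuous_map_scale:
  assumes "continuous_map \<sigma> \<tau> f"
  shows "continuous_map \<sigma> \<tau> (\<lambda>x. sc c (f x))"
  using assms unfolding continuous_map_atin by (blast intro: limitin_scale)

lemma closedin_ball:
  assumes "q \<in> P" "x \<in> X"
  shows "closedin \<tau> {y\<in>X. q (y - x) \<le> \<epsilon>}"
  unfolding closedin_def topspace_seminorm_topology openin_seminorm_topology
proof (intro conjI ballI)
  fix y assume "y \<in> X - {y\<in>X. q (y - x) \<le> \<epsilon>}"
  then have y: "y \<in> X" "\<epsilon> < q (y - x)" by auto
  have "{z\<in>X. \<forall>q\<in>{q}. q (z - y) < q (y - x) - \<epsilon>} \<subseteq> X - {y\<in>X. q (y - x) \<le> \<epsilon>}"
    using seminorm_diff_triangle[OF assms(1)] seminorm_minus_commute[OF assms(1)] y(1) assms(2)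
    by clarsimp (smt (verit))
  with y(2) assms(1) show "\<exists>F \<delta>. finite F \<and> F \<subseteq> P \<and> 0 < \<delta> \<and>
      {z\<in>X. \<forall>q\<in>F. q (z - y) < \<delta>} \<subseteq> X - {y\<in>X. q (y - x) \<le> \<epsilon>}"
    by (intro exI[of _ "{q}"] exI[of _ "q (y - x) - \<epsilon>"]) auto
qed auto

text \<open>Closed balls of half the radius fit into open balls. Regularity of the target is what
  the pointwise criterion for continuous extensions asks for.\<close>

lemma regular_space: "regular_space \<tau>"
  unfolding neighbourhood_base_of_closedin[symmetric] neighbourhood_base_of
proof (intro allI impI)
  fix W x assume "openin \<tau> W \<and> x \<in> W"
  then have W: "openin \<tau> W" "x \<in> W" "x \<in> X" using openin_subset[of \<tau> W] by auto
  then obtain F \<epsilon> where F: "finite F" "F \<subseteq> P" "0 < \<epsilon>" "{y\<in>X. \<forall>q\<in>F. q (y - x) < \<epsilon>} \<subseteq> W"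
    using openin_contains_ball by blast
  define \<delta> where "\<delta> = \<epsilon> / 2"
  then have \<delta>: "0 < \<delta>" "\<delta> < \<epsilon>" using F(3) by auto
  let ?U = "{y\<in>X. \<forall>q\<in>F. q (y - x) < \<delta>}"
  \<comment> \<open>Inserting \<open>X\<close> makes the intersection the right set when
    \<open>F\<close> is empty.\<close>
  let ?C = "\<Inter> (insert X ((\<lambda>q. {y\<in>X. q (y - x) \<le> \<delta>}) ` F))"
  have "closedin \<tau> X" using closedin_topspace[of \<tau>] by simp
  then have "closedin \<tau> ?C" using closedin_ball F(2) W(3) by (intro closedin_Inter) auto
  moreover have "?C \<subseteq> W" using F(4) \<delta>(2) by fastforce
  moreover have "openin \<tau> ?U" using F W \<delta> by (intro openin_ball) auto
  moreover have "x \<in> ?U" using F W \<delta> by (auto simp: seminorm_zero subset_iff)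
  moreover have "?U \<subseteq> ?C" by auto
  ultimately show "\<exists>U V. openin \<tau> U \<and> closedin \<tau> V \<and> x \<in> U \<and> U \<subseteq> V \<and> V \<subseteq> W"
    by blast
qed

lemma continuous_map_seminorm:
  assumes "q \<in> P" shows "continuous_map \<tau> euclideanreal q"
  unfolding continuous_map_atin
proof
  fix x assume "x \<in> topspace \<tau>"
  then have x: "x \<in> X" by simp
  show "limitin euclideanreal q (q x) (atin \<tau> x)"
    unfolding limitin_canonical_iff tendsto_iff
  proof (intro allI impI)
    fix \<epsilon> :: real assume "0 < \<epsilon>"
    have "continuous_map \<tau> \<tau> (\<lambda>x. x)" by simp
    then have "limitin \<tau> (\<lambda>x. x) x (atin \<tau> x)"
      unfolding continuous_map_atin using x by simp
    then have "\<forall>\<^sub>F y in atin \<tau> x. y \<in> X" "\<forall>\<^sub>F y in atin \<tau> x. q (y - x) < \<epsilon>"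
      using assms \<open>0 < \<epsilon>\<close> by (auto simp: limitin_iff)
    then show "\<forall>\<^sub>F y in atin \<tau> x. dist (q y) (q x) < \<epsilon>"
    proof eventually_elim
      case (elim y)
      have "q y \<le> q (y - x) + q x" "q x \<le> q (x - y) + q y"
        using seminorm_triangle[OF assms, of "y - x" x] seminorm_triangle[OF assms, of "x - y" y]
          elim x X_closed by auto
      moreover have "q (x - y) = q (y - x)" using assms x elim by (intro seminorm_minus_commute)
      ultimately show ?case using elim(2) by (auto simp: dist_real_def)
    qed
  qed
qed

end

section \<open>Extension by density\<close>

lemma linear_map_on_add: "linear_map_on sc sc' X f \<Longrightarrow> x \<in> X \<Longrightarrow> y \<in> X \<Longrightarrow> f (x + y) = f x + f y"
  and linear_map_on_scale: "linear_map_on sc sc' X f \<Longrightarrow> x \<in> X \<Longrightarrow> f (sc c x) = sc' c (f x)"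
  by (auto simp: linear_map_on_def)

lemma linear_map_on_zero:
  assumes "vector_space sc" "linear_map_on sc sc' X f" "module.subspace sc X"
  shows "f 0 = 0"
proof -
  interpret vector_space sc by fact
  have "f (0 + 0) = f 0 + f 0"
    using linear_map_on_add[OF assms(2)] subspace_0[OF assms(3)] by blast
  then show ?thesis by simp
qed

lemma linear_map_on_diff:
  assumes "vector_space sc" "linear_map_on sc sc' X f" "module.subspace sc X" "x \<in> X" "y \<in> X"
  shows "f (x - y) = f x - f y"
proof -
  interpret vector_space sc by fact
  have "f ((x - y) + y) = f (x - y) + f y"
    using linear_map_on_add[OF assms(2)] subspace_diff[OF assms(3-5)] assms(5) by blast
  then show ?thesis by (simp add: algebra_simps)
qed

lemma subspace_linear_image:
  assumes "vector_space sc" "vector_space sc'" "module.subspace sc X" "linear_map_on sc sc' X f"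
  shows "module.subspace sc' (f ` X)"
proof -
  interpret a: vector_space sc by fact
  interpret b: vector_space sc' by fact
  show ?thesis
  proof (rule b.subspaceI)
    show "0 \<in> f ` X"
      using linear_map_on_zero[OF assms(1,4,3)] a.subspace_0[OF assms(3)] by force
  next
    fix x y assume "x \<in> f ` X" "y \<in> f ` X"
    then obtain u v where "u \<in> X" "v \<in> X" "x = f u" "y = f v" by blast
    then show "x + y \<in> f ` X"
      using linear_map_on_add[OF assms(4), of u v] a.subspace_add[OF assms(3), of u v] by (metis image_eqI)
  next
    fix c x assume "x \<in> f ` X"
    then obtain u where "u \<in> X" "x = f u" by blast
    then show "sc' c x \<in> f ` X"
      using linear_map_on_scale[OF assms(4), of u c] a.subspace_scale[OF assms(3), of u c] by (metis image_eqI)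
  qed
qed

text \<open>A linear map that is continuous at 0 is uniformly continuous, so it sends the trace on
  \<open>D\<close> of the neighbourhoods of a point to a Cauchy filter. Completeness supplies a
  limit at each point, regularity makes the limits a continuous function, and linearity passes from
  \<open>D\<close> to its closure.\<close>

lemma continuous_linear_extension:
  fixes sc :: "'k::real_normed_field \<Rightarrow> 'a::ab_group_add \<Rightarrow> 'a"
    and sc' :: "'k \<Rightarrow> 'b::ab_group_add \<Rightarrow> 'b"
  assumes "lcs sc X P" "lcs sc' Y Q"
    and Y: "Hausdorff_space (seminorm_topology Y Q)" "complete_tvs Y (seminorm_topology Y Q)"
    and D: "module.subspace sc D" "D \<subseteq> X" "seminorm_topology X P closure_of D = X"
    and f: "linear_map_on sc sc' D f"
      "continuous_map (subtopology (seminorm_topology X P) D) (seminorm_topology Y Q) f"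
  obtains g where "continuous_map (seminorm_topology X P) (seminorm_topology Y Q) g"
    "linear_map_on sc sc' X g" "\<And>x. x \<in> D \<Longrightarrow> g x = f x"
proof -
  interpret X: lcs sc X P by fact
  interpret Y: lcs sc' Y Q by fact
  have fD: "f x \<in> Y" if "x \<in> D" for x
    using continuous_map_image_subset_topspace[OF f(2)] D(2) that by auto
  have f0: "f 0 = 0"
    using linear_map_on_zero[OF X.vector_space_axioms f(1) D(1)] .
  \<comment> \<open>At points of \<open>D\<close> the extension keeps the value of \<open>f\<close>,
    so limits are required only outside \<open>D\<close>.\<close>
  have lim: "\<exists>l. limitin Y.\<tau> f l (atin_within X.\<tau> t D)" if t: "t \<in> X - D" for t
  proof -
    let ?N = "atin_within X.\<tau> t D"
    have tX: "t \<in> X" using t by simp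
    have ev_ball: "\<forall>\<^sub>F x in ?N. x \<in> D \<and> x \<in> U" if "openin X.\<tau> U" "t \<in> U" for U
      using that unfolding eventually_atin_within by auto
    have "?N \<noteq> bot"
    proof
      assume "?N = bot"
      then have "\<forall>\<^sub>F x in ?N. False" by simp
      then obtain T where "openin X.\<tau> T" "t \<in> T" "T \<inter> D = {}"
        using t unfolding eventually_atin_within by auto
      moreover have "t \<in> X.\<tau> closure_of D" using D(3) t by simp
      ultimately show False by (auto simp: in_closure_of)
    qed
    moreover have "\<forall>\<^sub>F x in ?N. f x \<in> Y"
      using ev_ball[of X] openin_topspace[of X.\<tau>] t fD by (auto elim: eventually_mono)
    moreover have "\<exists>S. (\<forall>\<^sub>F x in filtermap f ?N. x \<in> S) \<and> (\<forall>x\<in>S. \<forall>y\<in>S. x - y \<in> U)"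
      if U: "openin Y.\<tau> U" "0 \<in> U" for U
    proof -
      have "openin (subtopology X.\<tau> D) {x \<in> topspace (subtopology X.\<tau> D). f x \<in> U}"
        using f(2) U(1) by (rule openin_continuous_map_preimage)
      then obtain V where V: "openin X.\<tau> V" "{x \<in> topspace (subtopology X.\<tau> D). f x \<in> U} = V \<inter> D"
        unfolding openin_subtopology by blast
      have "0 \<in> V" using V(2) f0 U(2) X.subspace_0[OF D(1)] D(2) by auto
      then obtain G \<epsilon> where G: "finite G" "G \<subseteq> P" "0 < \<epsilon>" "{y\<in>X. \<forall>q\<in>G. q (y - 0) < \<epsilon>} \<subseteq> V"
        using V(1) X.openin_contains_ball by blast
      \<comment> \<open>With radius \<open>\<epsilon> / 2\<close>, the difference of two points of
        \<open>D \<inter> B\<close> lies in the neighbourhood \<open>V\<close> of 0, and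
        \<open>f\<close> maps \<open>V \<inter> D\<close> into \<open>U\<close>.\<close>
      define B where "B = {x\<in>X. \<forall>q\<in>G. q (x - t) < \<epsilon> / 2}"
      have "0 < \<epsilon> / 2" using G by simp
      moreover from this have "q (t - t) < \<epsilon> / 2" if "q \<in> G" for q
        using X.seminorm_zero[OF subsetD[OF G(2) that]] by (metis diff_self)
      ultimately have B: "openin X.\<tau> B" "t \<in> B"
        using X.openin_ball[OF G(1,2) _ tX] tX unfolding B_def by blast+
      have "f x - f y \<in> U" if "x \<in> D \<inter> B" "y \<in> D \<inter> B" for x y
      proof -
        have xy: "x - y \<in> D" "x \<in> X" "y \<in> X" "x \<in> D" "y \<in> D"
          using that D(2) X.subspace_diff[OF D(1)] by auto
        have "q (x - y) < \<epsilon>" if "q \<in> G" for q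
        proof -
          have q: "q \<in> P" using that G by auto
          have "q (x - y) \<le> q (x - t) + q (y - t)"
            using X.seminorm_diff_triangle[OF q xy(2) tX xy(3)]
              X.seminorm_minus_commute[OF q xy(3) tX] by simp
          moreover have "q (x - t) < \<epsilon> / 2" "q (y - t) < \<epsilon> / 2"
            using \<open>x \<in> D \<inter> B\<close> \<open>y \<in> D \<inter> B\<close> that by (auto simp: B_def)
          ultimately show ?thesis by simp
        qed
        then have "x - y \<in> V \<inter> D" using G(4) xy X.X_closed by auto
        then have "f (x - y) \<in> U" using V(2) by blast
        then show ?thesis
          using linear_map_on_diff[OF X.vector_space_axioms f(1) D(1) xy(4,5)] by simp
      qed
      moreover have "\<forall>\<^sub>F x in filtermap f ?N. x \<in> f ` (D \<inter> B)"
        unfolding eventually_filtermap using ev_ball[OF B] by (auto elim: eventually_mono)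
      ultimately show ?thesis by (intro exI[of _ "f ` (D \<inter> B)"]) blast
    qed
    ultimately have "\<exists>l. limitin Y.\<tau> (\<lambda>x. x) l (filtermap f ?N)"
      using Y(2) unfolding complete_tvs_def
      by (simp add: filtermap_bot_iff eventually_filtermap)
    then show ?thesis by (simp add: limitin_def eventually_filtermap)
  qed
  obtain g where g: "continuous_map (subtopology X.\<tau> X) Y.\<tau> g" "\<And>x. x \<in> D \<Longrightarrow> g x = f x"
    using continuous_map_extension_pointwise_alt[OF Y.regular_space D(2) _ f(2) lim] D(3) by blast
  then have gc: "continuous_map X.\<tau> Y.\<tau> g" using subtopology_topspace[of X.\<tau>] by simp
  have "linear_map_on sc sc' X g"
    unfolding linear_map_on_def
  proof (intro conjI ballI allI)
    fix x y assume xy: "x \<in> X" "y \<in> X"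
    let ?PT = "prod_topology X.\<tau> X.\<tau>"
    \<comment> \<open>Additivity is an identity between two continuous maps on the product; both
      agree on the dense subset \<open>D \<times> D\<close>, and the target is Hausdorff.\<close>
    have "?PT closure_of (D \<times> D) = X \<times> X" by (simp add: closure_of_Times D(3))
    then have "(x, y) \<in> ?PT closure_of (D \<times> D)" using xy by simp
    moreover have "continuous_map ?PT Y.\<tau> (\<lambda>z. g (fst z + snd z))"
      using continuous_map_compose[OF X.continuous_map_add[OF continuous_map_fst continuous_map_snd] gc]
      by (simp add: o_def)
    moreover have "continuous_map ?PT Y.\<tau> (\<lambda>z. g (fst z) + g (snd z))"
      using continuous_map_compose[OF continuous_map_fst gc] continuous_map_compose[OF continuous_map_snd gc]
      by (intro Y.continuous_map_add) (simp_all add: o_def)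
    moreover have "g (fst z + snd z) = g (fst z) + g (snd z)" if "z \<in> D \<times> D" for z
      using that linear_map_on_add[OF f(1)] X.subspace_add[OF D(1)] g(2) by auto
    ultimately have "g (fst (x, y) + snd (x, y)) = g (fst (x, y)) + g (snd (x, y))"
      by (rule forall_in_closure_of_eq[OF _ Y(1)])
    then show "g (x + y) = g x + g y" by simp
  next
    fix c x assume "x \<in> X"
    then have "x \<in> X.\<tau> closure_of D" by (simp add: D(3))
    moreover have "continuous_map X.\<tau> Y.\<tau> (\<lambda>x. g (sc c x))"
      using continuous_map_compose[OF X.continuous_map_scale[of X.\<tau> "\<lambda>x. x"] gc] by (simp add: o_def)
    moreover have "continuous_map X.\<tau> Y.\<tau> (\<lambda>x. sc' c (g x))"
      by (intro Y.continuous_map_scale gc)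
    moreover have "g (sc c z) = sc' c (g z)" if "z \<in> D" for z
      using that linear_map_on_scale[OF f(1)] X.subspace_scale[OF D(1)] g(2) by auto
    ultimately show "g (sc c x) = sc' c (g x)"
      by (rule forall_in_closure_of_eq[OF _ Y(1)])
  qed
  with gc g(2) show ?thesis using that by blast
qed

text \<open>Finite sets of indices replace finite sets of functions, so that two families over the
  same \<Gamma> can be compared ball by ball even if an indexing is not injective.\<close>

lemma openin_seminorm_topology_image:
  "openin (seminorm_topology X (p ` \<Gamma>)) U \<longleftrightarrow> U \<subseteq> X \<and>
     (\<forall>x\<in>U. \<exists>F \<epsilon>. finite F \<and> F \<subseteq> \<Gamma> \<and> 0 < \<epsilon> \<and> {y\<in>X. \<forall>\<gamma>\<in>F. p \<gamma> (y - x) < \<epsilon>} \<subseteq> U)"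
proof -
  have "(\<exists>F \<epsilon>. finite F \<and> F \<subseteq> p ` \<Gamma> \<and> 0 < \<epsilon> \<and> {y\<in>X. \<forall>q\<in>F. q (y - x) < \<epsilon>} \<subseteq> U) \<longleftrightarrow>
        (\<exists>F \<epsilon>. finite F \<and> F \<subseteq> \<Gamma> \<and> 0 < \<epsilon> \<and> {y\<in>X. \<forall>\<gamma>\<in>F. p \<gamma> (y - x) < \<epsilon>} \<subseteq> U)" for x
    using ex_finite_subset_image[of p \<Gamma> "\<lambda>F. \<exists>\<epsilon>. 0 < \<epsilon> \<and> {y\<in>X. \<forall>q\<in>F. q (y - x) < \<epsilon>} \<subseteq> U"]
    by simp
  then show ?thesis unfolding openin_seminorm_topology by simp
qed

text \<open>Balls evaluate seminorms only at differences of elements of \<open>X\<close>. This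
  matters because the tower fixes its seminorms on the carriers alone.\<close>

lemma seminorm_topology_image_cong:
  assumes "vector_space sc" "module.subspace sc X" "\<And>\<gamma> x. \<gamma> \<in> \<Gamma> \<Longrightarrow> x \<in> X \<Longrightarrow> p \<gamma> x = q \<gamma> x"
  shows "seminorm_topology X (p ` \<Gamma>) = seminorm_topology X (q ` \<Gamma>)"
proof -
  interpret vector_space sc by fact
  have "{y\<in>X. \<forall>\<gamma>\<in>F. p \<gamma> (y - x) < \<epsilon>} = {y\<in>X. \<forall>\<gamma>\<in>F. q \<gamma> (y - x) < \<epsilon>}"
    if "F \<subseteq> \<Gamma>" "x \<in> X" for F x and \<epsilon> :: real
    using assms(3) subspace_diff[OF assms(2)] that by (auto simp: subset_iff)
  then have "(finite F \<and> F \<subseteq> \<Gamma> \<and> 0 < \<epsilon> \<and> {y\<in>X. \<forall>\<gamma>\<in>F. p \<gamma> (y - x) < \<epsilon>} \<subseteq> U) \<longleftrightarrow>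
      (finite F \<and> F \<subseteq> \<Gamma> \<and> 0 < \<epsilon> \<and> {y\<in>X. \<forall>\<gamma>\<in>F. q \<gamma> (y - x) < \<epsilon>} \<subseteq> U)"
    if "x \<in> X" for F x \<epsilon> U
    using that by (cases "F \<subseteq> \<Gamma>") simp_all
  then have eq: "(\<exists>F \<epsilon>. finite F \<and> F \<subseteq> \<Gamma> \<and> 0 < \<epsilon> \<and> {y\<in>X. \<forall>\<gamma>\<in>F. p \<gamma> (y - x) < \<epsilon>} \<subseteq> U) \<longleftrightarrow>
      (\<exists>F \<epsilon>. finite F \<and> F \<subseteq> \<Gamma> \<and> 0 < \<epsilon> \<and> {y\<in>X. \<forall>\<gamma>\<in>F. q \<gamma> (y - x) < \<epsilon>} \<subseteq> U)"
    if "x \<in> X" for x U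
    using that by (intro ex_cong1)
  show ?thesis
    unfolding topology_eq openin_seminorm_topology_image
    by (intro allI conj_cong refl ball_cong) (rule eq, erule (1) subsetD)
qed

text \<open>A homeomorphism is a quotient map, so the source topology and the map determine the
  target topology. In this way a topology that is given abstractly gets identified with one defined
  by seminorms.\<close>

lemma homeomorphic_map_target_unique:
  assumes "homeomorphic_map \<tau> \<sigma> f" "homeomorphic_map \<tau> \<sigma>' f"
  shows "\<sigma> = \<sigma>'"
proof -
  have q: "quotient_map \<tau> \<sigma> f" "quotient_map \<tau> \<sigma>' f"
    using assms by (auto simp: homeomorphic_map_def)
  then have t: "topspace \<sigma> = topspace \<sigma>'" by (auto simp: quotient_map_def)
  have "openin \<sigma> U \<longleftrightarrow> openin \<sigma>' U" for U
  proof (cases "U \<subseteq> topspace \<sigma>")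
    case True
    then show ?thesis using q t unfolding quotient_map_def by auto
  next
    case False
    then show ?thesis using openin_subset[of \<sigma> U] openin_subset[of \<sigma>' U] t by auto
  qed
  then show ?thesis unfolding topology_eq by blast
qed

text \<open>The definite description ranges over extensional functions, so it denotes the
  restriction of \<open>g\<close> to the space; extensionality turns uniqueness on the space into
  equality of functions.\<close>

lemma continuous_extension_eq:
  assumes "unique_continuous_extension \<tau> \<sigma> Y f g" "x \<in> topspace \<tau>" "Y \<subseteq> topspace \<tau>"
  shows "continuous_extension \<tau> \<sigma> Y f x = g x"
proof -
  let ?g = "restrict g (topspace \<tau>)"
  have g: "continuous_map \<tau> \<sigma> g" "\<forall>y\<in>Y. g y = f y"
    "\<And>h. continuous_map \<tau> \<sigma> h \<Longrightarrow> \<forall>y\<in>Y. h y = f y \<Longrightarrow> \<forall>x\<in>topspace \<tau>. h x = g x"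
    using assms(1) by (auto simp: unique_continuous_extension_def)
  have "continuous_extension \<tau> \<sigma> Y f = ?g"
    unfolding continuous_extension_def
  proof (rule the_equality)
    have "continuous_map \<tau> \<sigma> ?g" using g(1) by (rule continuous_map_eq) simp
    then show "?g \<in> extensional (topspace \<tau>) \<and> continuous_map \<tau> \<sigma> ?g \<and> (\<forall>y\<in>Y. ?g y = f y)"
      using g(2) assms(3) by auto
  next
    fix h assume "h \<in> extensional (topspace \<tau>) \<and> continuous_map \<tau> \<sigma> h \<and> (\<forall>y\<in>Y. h y = f y)"
    then show "h = ?g" using g(3)[of h] by (intro extensionalityI[of _ "topspace \<tau>"]) auto
  qed
  then show ?thesis using assms(2) by simp
qed

lemma unique_continuous_extensionI:
  assumes "continuous_map \<tau> \<sigma> g" "\<And>y. y \<in> Y \<Longrightarrow> g y = f y"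
    "\<tau> closure_of Y = topspace \<tau>" "Hausdorff_space \<sigma>"
  shows "unique_continuous_extension \<tau> \<sigma> Y f g"
  unfolding unique_continuous_extension_def
proof (intro conjI allI impI ballI)
  fix h x assume h: "continuous_map \<tau> \<sigma> h \<and> (\<forall>y\<in>Y. h y = f y)" and x: "x \<in> topspace \<tau>"
  show "h x = g x"
    by (rule forall_in_closure_of_eq[of x \<tau> Y]) (use h x assms in auto)
qed (use assms in auto)

section \<open>Transport along linear homeomorphisms\<close>

abbreviation difference_quotient ::
  "('k::real_normed_field \<Rightarrow> 'a::ab_group_add \<Rightarrow> 'a) \<Rightarrow> (real \<Rightarrow> 'a \<Rightarrow> 'a) \<Rightarrow> 'a \<Rightarrow> real \<Rightarrow> 'a" where
  "difference_quotient sc T x \<equiv> \<lambda>t. sc (of_real (1 / t)) (T t x - x)"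

lemma generator_limit:
  assumes "Hausdorff_space \<tau>" "x \<in> generator_domain sc X \<tau> T"
  shows "limitin \<tau> (difference_quotient sc T x) (generator sc \<tau> T x) (at_right 0)"
proof -
  obtain y where y: "limitin \<tau> (difference_quotient sc T x) y (at_right 0)"
    using assms(2) by (auto simp: generator_domain_def)
  then have "generator sc \<tau> T x = y"
    unfolding generator_def
    by (intro the_equality) (auto intro: limitin_Hausdorff_unique[OF _ _ _ assms(1)])
  with y show ?thesis by simp
qed

lemma generator_eqI:
  assumes "Hausdorff_space \<tau>" "limitin \<tau> (difference_quotient sc T x) y (at_right 0)"
  shows "generator sc \<tau> T x = y"
  unfolding generator_def using assms(2)
  by (intro the_equality) (auto intro: limitin_Hausdorff_unique[OF _ _ _ assms(1)])

text \<open>The topologies are arbitrary here: completeness, semigroups and generators refer to a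
  topology and not to a family of seminorms.\<close>

locale linear_homeomorphism = dom: vector_space sc + cod: vector_space sc'
  for sc :: "'k::real_normed_field \<Rightarrow> 'a::ab_group_add \<Rightarrow> 'a"
    and sc' :: "'k \<Rightarrow> 'b::ab_group_add \<Rightarrow> 'b" +
  fixes X :: "'a set" and \<tau> :: "'a topology" and X' :: "'b set" and \<sigma> :: "'b topology" and e :: "'a \<Rightarrow> 'b"
  assumes subspace_X: "dom.subspace X"
    and top: "topspace \<tau> = X" "topspace \<sigma> = X'"
    and homeo: "homeomorphic_map \<tau> \<sigma> e"
    and linear: "linear_map_on sc sc' X e"
begin

definition "e_inv = inv_into X e"

lemma image_X: "e ` X = X'" and inj: "inj_on e X"
  using homeo homeomorphic_imp_surjective_map homeomorphic_imp_injective_map top by blast+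

lemma e_inv [simp]: "x \<in> X \<Longrightarrow> e_inv (e x) = x"
  and e_e_inv [simp]: "y \<in> X' \<Longrightarrow> e (e_inv y) = y"
  and e_inv_mem: "y \<in> X' \<Longrightarrow> e_inv y \<in> X" and e_mem: "x \<in> X \<Longrightarrow> e x \<in> X'"
  using image_X inj by (auto simp: e_inv_def f_inv_into_f inv_into_into)

lemma homeo_maps: "homeomorphic_maps \<tau> \<sigma> e e_inv"
proof -
  obtain g where g: "homeomorphic_maps \<tau> \<sigma> e g" using homeo homeomorphic_map_maps by blast
  have "g y = e_inv y" if "y \<in> X'" for y
    using g that by (metis e_e_inv e_inv e_inv_mem homeomorphic_maps_def top(1))
  then show ?thesis
    using g homeomorphic_maps_eq top by metis
qed

lemma continuous_e: "continuous_map \<tau> \<sigma> e" and continuous_e_inv: "continuous_map \<sigma> \<tau> e_inv"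
  using homeo_maps by (auto simp: homeomorphic_maps_def)

lemma openin_image: "openin \<tau> U \<Longrightarrow> openin \<sigma> (e ` U)"
  using homeo homeomorphic_map_openness openin_subset by blast

lemma openin_vimage: "openin \<sigma> U \<Longrightarrow> openin \<tau> {x\<in>X. e x \<in> U}"
  using openin_continuous_map_preimage[OF continuous_e] top by simp

text \<open>Eventual membership in \<open>X\<close> is needed for the way back: \<open>e\<close> is
  injective only on \<open>X\<close>, so \<open>e (f t) \<in> X'\<close> alone says nothing about
  \<open>f t\<close>.\<close>

lemma limitin_image:
  assumes "l \<in> X" "\<forall>\<^sub>F t in F. f t \<in> X"
  shows "limitin \<sigma> (\<lambda>t. e (f t)) (e l) F \<longleftrightarrow> limitin \<tau> f l F"
proof
  assume "limitin \<tau> f l F"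
  from continuous_map_limit[OF continuous_e this] show "limitin \<sigma> (\<lambda>t. e (f t)) (e l) F"
    by (simp add: o_def)
next
  assume "limitin \<sigma> (\<lambda>t. e (f t)) (e l) F"
  from continuous_map_limit[OF continuous_e_inv this]
  have "limitin \<tau> (\<lambda>t. e_inv (e (f t))) l F" using assms(1) by (simp add: o_def)
  moreover have "\<forall>\<^sub>F t in F. e_inv (e (f t)) = f t" using assms(2) by eventually_elim simp
  ultimately show "limitin \<tau> f l F" by (rule limitin_transform_eventually[rotated])
qed

lemmas e_zero = linear_map_on_zero[OF dom.vector_space_axioms linear subspace_X]
lemmas e_diff = linear_map_on_diff[OF dom.vector_space_axioms linear subspace_X]
lemmas e_add = linear_map_on_add[OF linear]
lemmas e_scale = linear_map_on_scale[OF linear]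
lemmas X_closed = dom.subspace_0[OF subspace_X] dom.subspace_add[OF subspace_X]
  dom.subspace_diff[OF subspace_X] dom.subspace_scale[OF subspace_X]

lemma subspace_X': "cod.subspace X'"
  using subspace_linear_image[OF dom.vector_space_axioms cod.vector_space_axioms subspace_X linear] image_X
  by simp

lemma linear_e_inv: "linear_map_on sc' sc X' e_inv"
  unfolding linear_map_on_def
proof (intro conjI ballI allI)
  fix x y assume "x \<in> X'" "y \<in> X'"
  then have "e (e_inv x + e_inv y) = x + y" "e_inv x + e_inv y \<in> X"
    using e_add e_inv_mem X_closed by auto
  then show "e_inv (x + y) = e_inv x + e_inv y" by (metis e_inv)
next
  fix c x assume "x \<in> X'"
  then have "e (sc c (e_inv x)) = sc' c x" "sc c (e_inv x) \<in> X"
    using e_scale e_inv_mem X_closed by auto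
  then show "e_inv (sc' c x) = sc c (e_inv x)" by (metis e_inv)
qed

lemma complete_image:
  assumes "complete_tvs X \<tau>" shows "complete_tvs X' \<sigma>"
  unfolding complete_tvs_def
proof (intro allI impI)
  fix F
  assume F: "F \<noteq> bot \<and> (\<forall>\<^sub>F x in F. x \<in> X') \<and>
    (\<forall>U. openin \<sigma> U \<and> 0 \<in> U \<longrightarrow> (\<exists>S. (\<forall>\<^sub>F x in F. x \<in> S) \<and> (\<forall>x\<in>S. \<forall>y\<in>S. x - y \<in> U)))"
  then have X': "\<forall>\<^sub>F x in F. x \<in> X'" by simp
  let ?G = "filtermap e_inv F"
  have "?G \<noteq> bot" using F by (simp add: filtermap_bot_iff)
  moreover have "\<forall>\<^sub>F x in ?G. x \<in> X"
    unfolding eventually_filtermap using X' by eventually_elim (rule e_inv_mem)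
  moreover have "\<exists>S. (\<forall>\<^sub>F x in ?G. x \<in> S) \<and> (\<forall>x\<in>S. \<forall>y\<in>S. x - y \<in> U)"
    if U: "openin \<tau> U" "0 \<in> U" for U
  proof -
    have "openin \<sigma> (e ` U)" "0 \<in> e ` U"
      using openin_image[OF U(1)] e_zero U(2) by (auto intro: rev_image_eqI)
    then obtain S where S: "\<forall>\<^sub>F x in F. x \<in> S" "\<And>x y. x \<in> S \<Longrightarrow> y \<in> S \<Longrightarrow> x - y \<in> e ` U"
      using F by meson
    have "\<forall>\<^sub>F x in ?G. x \<in> e_inv ` (S \<inter> X')"
      unfolding eventually_filtermap using X' S(1) by eventually_elim blast
    moreover have "e_inv x - e_inv y \<in> U" if "x \<in> S \<inter> X'" "y \<in> S \<inter> X'" for x y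
    proof -
      obtain u where u: "u \<in> U" "x - y = e u" using S(2) \<open>x \<in> S \<inter> X'\<close> \<open>y \<in> S \<inter> X'\<close> by blast
      then have "u \<in> X" using openin_subset[OF U(1)] top by blast
      moreover have "e_inv x - e_inv y \<in> X" "e (e_inv x - e_inv y) = x - y"
        using that e_inv_mem X_closed e_diff by auto
      ultimately show ?thesis using u by (metis e_inv)
    qed
    ultimately show ?thesis by (intro exI[of _ "e_inv ` (S \<inter> X')"]) blast
  qed
  ultimately have "\<exists>l. limitin \<tau> (\<lambda>x. x) l ?G"
    by (intro assms[unfolded complete_tvs_def, THEN spec, THEN mp] conjI allI impI) blast+
  then obtain l where l: "limitin \<tau> (\<lambda>x. x) l ?G" ..
  then have lX: "l \<in> X" using limitin_topspace top by metis
  have "limitin \<tau> e_inv l F" using l by (simp add: limitin_def eventually_filtermap)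
  then have "limitin \<sigma> (\<lambda>x. e (e_inv x)) (e l) F"
    using continuous_map_limit[OF continuous_e] by (fastforce simp: o_def)
  moreover have "\<forall>\<^sub>F x in F. e (e_inv x) = x" using X' by eventually_elim simp
  ultimately have "limitin \<sigma> (\<lambda>x. x) (e l) F" by (rule limitin_transform_eventually[rotated])
  then show "\<exists>l. limitin \<sigma> (\<lambda>x. x) l F" ..
qed

lemma Hausdorff_image: "Hausdorff_space \<tau> \<Longrightarrow> Hausdorff_space \<sigma>"
  using homeomorphic_map_imp_homeomorphic_space[OF homeo] homeomorphic_Hausdorff_space by blast

section \<open>Transport of a semigroup and its generator\<close>

context
  fixes T :: "real \<Rightarrow> 'a \<Rightarrow> 'a" and T' :: "real \<Rightarrow> 'b \<Rightarrow> 'b"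
  assumes sg: "sc_ee_semigroup sc X \<tau> T"
    and T': "\<And>t x. 0 \<le> t \<Longrightarrow> x \<in> X \<Longrightarrow> T' t (e x) = e (T t x)"
begin

lemma T_mem: "0 \<le> t \<Longrightarrow> x \<in> X \<Longrightarrow> T t x \<in> X"
  using sg continuous_map_image_subset_topspace top unfolding sc_ee_semigroup_def by blast

lemma T'_eq: "0 \<le> t \<Longrightarrow> y \<in> X' \<Longrightarrow> T' t y = e (T t (e_inv y))"
  using T'[of t "e_inv y"] by (simp add: e_inv_mem)

text \<open>On \<open>X'\<close> the operator \<open>T' t\<close> is the conjugate of
  \<open>T t\<close> by \<open>e\<close>. The same \<omega> works, because \<open>e\<close> commutes
  with scalars and preserves differences, so neighbourhoods of 0 can be carried back and
  forth.\<close>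

lemma semigroup_image: "sc_ee_semigroup sc' X' \<sigma> T'"
  unfolding sc_ee_semigroup_def
proof (intro conjI allI impI ballI)
  fix t :: real assume t: "0 \<le> t"
  have Tt: "linear_map_on sc sc X (T t)" "continuous_map \<tau> \<tau> (T t)"
    using sg t by (auto simp: sc_ee_semigroup_def)
  show "linear_map_on sc' sc' X' (T' t)"
    unfolding linear_map_on_def
    using linear_map_on_add[OF Tt(1)] linear_map_on_scale[OF Tt(1)] linear_map_on_add[OF linear_e_inv]
      linear_map_on_scale[OF linear_e_inv] e_add e_scale cod.subspace_add[OF subspace_X']
      cod.subspace_scale[OF subspace_X'] T_mem[OF t] e_inv_mem T'_eq[OF t] by simp
  have "continuous_map \<sigma> \<sigma> (\<lambda>y. e (T t (e_inv y)))"
    using continuous_map_compose[OF continuous_map_compose[OF continuous_e_inv Tt(2)] continuous_e]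
    by (simp add: o_def)
  then show "continuous_map \<sigma> \<sigma> (T' t)"
    by (rule continuous_map_eq) (simp add: T'_eq t top)
  fix s :: real and x assume "0 \<le> s" "x \<in> X'"
  then show "T' (t + s) x = T' t (T' s x)"
    using sg t by (simp add: T'_eq e_inv_mem e_mem T_mem sc_ee_semigroup_def)
next
  fix x assume x: "x \<in> X'"
  then show "T' 0 x = x"
    using sg by (simp add: T'_eq e_inv_mem sc_ee_semigroup_def)
  have "continuous_map (top_of_set {0..}) \<tau> (\<lambda>t. T t (e_inv x))"
    using sg x by (simp add: e_inv_mem sc_ee_semigroup_def)
  from continuous_map_compose[OF this continuous_e]
  have "continuous_map (top_of_set {0..}) \<sigma> (\<lambda>t. e (T t (e_inv x)))" by (simp add: o_def)
  then show "continuous_map (top_of_set {0..}) \<sigma> (\<lambda>t. T' t x)"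
    by (rule continuous_map_eq) (simp add: T'_eq x)
next
  obtain \<omega> where eq: "equicontinuous_on X \<tau> {\<lambda>x. sc (of_real (exp (\<omega> * t))) (T t x) | t. 0 \<le> t}"
    using sg by (auto simp: sc_ee_semigroup_def)
  have "equicontinuous_on X' \<sigma> {\<lambda>x. sc' (of_real (exp (\<omega> * t))) (T' t x) | t. 0 \<le> t}"
    unfolding equicontinuous_on_def
  proof (intro ballI allI impI)
    fix x U assume x: "x \<in> X'" and U: "openin \<sigma> U \<and> 0 \<in> U"
    then have "openin \<tau> {x\<in>X. e x \<in> U}" "0 \<in> {x\<in>X. e x \<in> U}"
      using openin_vimage e_zero X_closed(1) by auto
    then obtain V where V: "openin \<tau> V" "0 \<in> V"
      "\<And>t y. 0 \<le> t \<Longrightarrow> y \<in> X \<Longrightarrow> y - e_inv x \<in> V \<Longrightarrow>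
        e (sc (of_real (exp (\<omega> * t))) (T t y) - sc (of_real (exp (\<omega> * t))) (T t (e_inv x))) \<in> U"
      using eq e_inv_mem[OF x] unfolding equicontinuous_on_def by (fastforce elim!: ballE)
    have "sc' (of_real (exp (\<omega> * t))) (T' t y) - sc' (of_real (exp (\<omega> * t))) (T' t x) \<in> U"
      if ty: "0 \<le> t" "y \<in> X'" "y - x \<in> e ` V" for t y
    proof -
      obtain v where v: "v \<in> V" "y - x = e v" using ty by blast
      then have "v \<in> X" using openin_subset[OF V(1)] top by blast
      then have "e_inv y - e_inv x = v"
        using v e_diff[of "e_inv y" "e_inv x"] ty(2) x e_inv_mem X_closed(3) by (metis e_e_inv e_inv)
      then show ?thesis
        using V(3)[OF ty(1) e_inv_mem[OF ty(2)]] v(1) ty(1,2) x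
        by (simp add: e_diff e_scale T'_eq T_mem e_inv_mem X_closed)
    qed
    moreover have "openin \<sigma> (e ` V)" "0 \<in> e ` V"
      using openin_image[OF V(1)] e_zero V(2) by (auto intro: rev_image_eqI)
    ultimately show "\<exists>V. openin \<sigma> V \<and> 0 \<in> V \<and> (\<forall>S\<in>{\<lambda>x. sc' (of_real (exp (\<omega> * t))) (T' t x) | t. 0 \<le> t}.
        \<forall>y\<in>X'. y - x \<in> V \<longrightarrow> S y - S x \<in> U)"
      by (intro exI[of _ "e ` V"]) blast
  qed
  then show "\<exists>\<omega>. equicontinuous_on X' \<sigma> {\<lambda>x. sc' (of_real (exp (\<omega> * t))) (T' t x) | t. 0 \<le> t}" ..
qed

text \<open>By linearity the difference quotient of \<open>e x\<close> is the image of the one of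
  \<open>x\<close>. The relation between \<open>T'\<close> and \<open>T\<close> holds for
  nonnegative times only, which a limit from the right respects.\<close>

lemma quotient_limit_image:
  assumes "x \<in> X" "y \<in> X"
  shows "limitin \<sigma> (difference_quotient sc' T' (e x)) (e y) (at_right 0) \<longleftrightarrow>
    limitin \<tau> (difference_quotient sc T x) y (at_right 0)"
proof -
  have pos: "\<forall>\<^sub>F t in at_right 0. 0 < (t::real)" by (simp add: eventually_at_right_less)
  have eq: "\<forall>\<^sub>F t in at_right 0. difference_quotient sc' T' (e x) t = e (difference_quotient sc T x t)"
    using pos by eventually_elim (simp add: T' assms e_scale e_diff T_mem X_closed)
  have "limitin \<sigma> (difference_quotient sc' T' (e x)) (e y) (at_right 0) \<longleftrightarrow>
    limitin \<sigma> (\<lambda>t. e (difference_quotient sc T x t)) (e y) (at_right 0)"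
    by (rule iffI[OF limitin_transform_eventually[OF eq]
          limitin_transform_eventually[OF eventually_mono[OF eq sym]]])
  also have "\<dots> \<longleftrightarrow> limitin \<tau> (difference_quotient sc T x) y (at_right 0)"
    using pos by (intro limitin_image assms) (auto elim!: eventually_mono simp: T_mem X_closed assms)
  finally show ?thesis .
qed

lemma generator_domain_image: "generator_domain sc' X' \<sigma> T' = e ` generator_domain sc X \<tau> T"
proof (intro equalityI subsetI)
  fix x' assume "x' \<in> generator_domain sc' X' \<sigma> T'"
  then obtain y' where x': "x' \<in> X'" and lim: "limitin \<sigma> (difference_quotient sc' T' x') y' (at_right 0)"
    by (auto simp: generator_domain_def)
  have y': "y' \<in> X'" using limitin_topspace[OF lim] top by simp
  have "limitin \<tau> (difference_quotient sc T (e_inv x')) (e_inv y') (at_right 0)"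
    using lim x' y' quotient_limit_image[of "e_inv x'" "e_inv y'"] by (simp add: e_inv_mem)
  then have "e_inv x' \<in> generator_domain sc X \<tau> T"
    using x' by (auto simp: generator_domain_def e_inv_mem)
  then have "e (e_inv x') \<in> e ` generator_domain sc X \<tau> T" by (rule imageI)
  then show "x' \<in> e ` generator_domain sc X \<tau> T" using x' by simp
next
  fix x' assume "x' \<in> e ` generator_domain sc X \<tau> T"
  then obtain x y where x: "x' = e x" "x \<in> X" and lim: "limitin \<tau> (difference_quotient sc T x) y (at_right 0)"
    by (auto simp: generator_domain_def)
  have "y \<in> X" using limitin_topspace[OF lim] top by simp
  then show "x' \<in> generator_domain sc' X' \<sigma> T'"
    using quotient_limit_image[of x y] x lim by (auto simp: generator_domain_def e_mem)
qed

lemma generator_image: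
  assumes "Hausdorff_space \<tau>" "x \<in> generator_domain sc X \<tau> T"
  shows "generator sc' \<sigma> T' (e x) = e (generator sc \<tau> T x)"
proof (rule generator_eqI[OF Hausdorff_image[OF assms(1)]])
  note lim = generator_limit[OF assms]
  have "x \<in> X" "generator sc \<tau> T x \<in> X"
    using assms(2) limitin_topspace[OF lim] top by (auto simp: generator_domain_def)
  then show "limitin \<sigma> (difference_quotient sc' T' (e x)) (e (generator sc \<tau> T x)) (at_right 0)"
    using quotient_limit_image lim by blast
qed

text \<open>The transported generator is the conjugate of the old one by \<open>e\<close>, hence so
  is its inverse, which is then a composition of continuous maps.\<close>

lemma inv_generator_image:
  assumes H: "Hausdorff_space \<tau>"
    and bij: "bij_betw (generator sc \<tau> T) (generator_domain sc X \<tau> T) X"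
    and cont: "continuous_map \<tau> \<tau> (inv_into (generator_domain sc X \<tau> T) (generator sc \<tau> T))"
  shows "bij_betw (generator sc' \<sigma> T') (generator_domain sc' X' \<sigma> T') X'"
    and "continuous_map \<sigma> \<sigma> (inv_into (generator_domain sc' X' \<sigma> T') (generator sc' \<sigma> T'))"
proof -
  let ?D = "generator_domain sc X \<tau> T" and ?A = "generator sc \<tau> T"
  let ?D' = "generator_domain sc' X' \<sigma> T'" and ?A' = "generator sc' \<sigma> T'"
  have DX: "?D \<subseteq> X" by (auto simp: generator_domain_def)
  have A': "?A' (e x) = e (?A x)" if "x \<in> ?D" for x using generator_image[OF H that] .
  show bij': "bij_betw ?A' ?D' X'"
    unfolding bij_betw_def
  proof
    show "inj_on ?A' ?D'"
    proof (rule inj_onI)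
      fix x y assume "x \<in> ?D'" "y \<in> ?D'" and eq: "?A' x = ?A' y"
      then obtain u v where uv: "u \<in> ?D" "x = e u" "v \<in> ?D" "y = e v"
        unfolding generator_domain_image by blast
      then have "e (?A u) = e (?A v)" using eq A' by simp
      moreover have "?A u \<in> X" "?A v \<in> X" using uv bij by (auto simp: bij_betw_def)
      ultimately have "?A u = ?A v" using inj by (meson inj_onD)
      then have "u = v" using bij uv by (meson bij_betw_def inj_onD)
      then show "x = y" using uv by simp
    qed
    have "?A' ` ?D' = e ` (?A ` ?D)"
      unfolding generator_domain_image image_image using A' by (intro image_cong) auto
    also have "\<dots> = X'" using bij image_X by (simp add: bij_betw_def)
    finally show "?A' ` ?D' = X'" .
  qed
  have "continuous_map \<sigma> \<sigma> (\<lambda>y. e (inv_into ?D ?A (e_inv y)))"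
    using continuous_map_compose[OF continuous_map_compose[OF continuous_e_inv cont] continuous_e]
    by (simp add: o_def)
  then show "continuous_map \<sigma> \<sigma> (inv_into ?D' ?A')"
  proof (rule continuous_map_eq)
    fix y assume "y \<in> topspace \<sigma>"
    then have y: "y \<in> X'" by (simp add: top)
    let ?x = "inv_into ?D ?A (e_inv y)"
    have x: "?x \<in> ?D" "?A ?x = e_inv y"
      using bij e_inv_mem[OF y] by (auto simp: bij_betw_def inv_into_into f_inv_into_f)
    then have "e ?x \<in> ?D'" "?A' (e ?x) = y"
      using A'[OF x(1)] y by (auto simp: generator_domain_image)
    then show "e ?x = inv_into ?D' ?A' y"
      using bij' by (metis bij_betw_inv_into_left)
  qed
qed

end

end

section \<open>Semigroups with invertible generator\<close>

text \<open>For each finite index set and radius, \<open>e\<close> maps the ball around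
  \<open>x\<close> onto the ball around \<open>e x\<close>. A homeomorphism is an injective quotient
  map, so no inverse has to be named.\<close>

lemma isometry_homeomorphic_map:
  assumes "vector_space sc" "vector_space sc'" "module.subspace sc X" "linear_map_on sc sc' X e" "inj_on e X"
    and iso: "\<And>\<gamma> x. \<gamma> \<in> \<Gamma> \<Longrightarrow> x \<in> X \<Longrightarrow> p' \<gamma> (e x) = p \<gamma> x"
  shows "homeomorphic_map (seminorm_topology X (p ` \<Gamma>)) (seminorm_topology (e ` X) (p' ` \<Gamma>)) e"
  unfolding homeomorphic_map_def quotient_map_def topspace_seminorm_topology
proof (intro conjI allI impI refl assms(5))
  interpret a: vector_space sc by fact
  fix U assume U: "U \<subseteq> e ` X"
  let ?V = "{x\<in>X. e x \<in> U}"
  have ball: "{y'\<in>e ` X. \<forall>\<gamma>\<in>F. p' \<gamma> (y' - e x) < \<epsilon>} \<subseteq> U \<longleftrightarrow> {y\<in>X. \<forall>\<gamma>\<in>F. p \<gamma> (y - x) < \<epsilon>} \<subseteq> ?V"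
    if F: "F \<subseteq> \<Gamma>" and x: "x \<in> X" for F x and \<epsilon> :: real
  proof -
    have "p' \<gamma> (e y - e x) = p \<gamma> (y - x)" if "\<gamma> \<in> F" "y \<in> X" for \<gamma> y
      using iso[of \<gamma> "y - x"] that F x a.subspace_diff[OF assms(3)]
        linear_map_on_diff[OF assms(1,4,3)] by auto
    then have "{y'\<in>e ` X. \<forall>\<gamma>\<in>F. p' \<gamma> (y' - e x) < \<epsilon>} = e ` {y\<in>X. \<forall>\<gamma>\<in>F. p \<gamma> (y - x) < \<epsilon>}"
      by auto
    then show ?thesis by (simp only: image_subset_iff) blast
  qed
  have ex: "(\<exists>F \<epsilon>. finite F \<and> F \<subseteq> \<Gamma> \<and> 0 < \<epsilon> \<and> {y'\<in>e ` X. \<forall>\<gamma>\<in>F. p' \<gamma> (y' - e x) < \<epsilon>} \<subseteq> U) \<longleftrightarrow>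
      (\<exists>F \<epsilon>. finite F \<and> F \<subseteq> \<Gamma> \<and> 0 < \<epsilon> \<and> {y\<in>X. \<forall>\<gamma>\<in>F. p \<gamma> (y - x) < \<epsilon>} \<subseteq> ?V)" if "x \<in> X" for x
    using ball[OF _ that] by (intro ex_cong1 conj_cong refl)
  have U_ball: "(\<forall>x'\<in>U. Q x') \<longleftrightarrow> (\<forall>x\<in>?V. Q (e x))" for Q using U by blast
  show "openin (seminorm_topology X (p ` \<Gamma>)) ?V = openin (seminorm_topology (e ` X) (p' ` \<Gamma>)) U"
    unfolding openin_seminorm_topology_image U_ball
    by (intro conj_cong ball_cong refl ex[symmetric]) (use U in auto)
qed

lemma (in lcs) subtopology_subspace:
  assumes "subspace Y" "Y \<subseteq> X"
  shows "subtopology \<tau> Y = seminorm_topology Y P"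
  unfolding topology_eq
proof (intro allI iffI)
  fix U assume "openin (subtopology \<tau> Y) U"
  then obtain V where V: "openin \<tau> V" "U = V \<inter> Y" unfolding openin_subtopology by blast
  show "openin (seminorm_topology Y P) U"
    unfolding openin_seminorm_topology
  proof (intro conjI ballI)
    fix x assume "x \<in> U"
    then obtain F \<epsilon> where "finite F" "F \<subseteq> P" "0 < \<epsilon>" "{y\<in>X. \<forall>q\<in>F. q (y - x) < \<epsilon>} \<subseteq> V"
      using V openin_contains_ball by blast
    then show "\<exists>F \<epsilon>. finite F \<and> F \<subseteq> P \<and> 0 < \<epsilon> \<and> {y\<in>Y. \<forall>q\<in>F. q (y - x) < \<epsilon>} \<subseteq> U"
      using assms(2) V(2) by (intro exI[of _ F] exI[of _ \<epsilon>]) auto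
  qed (use V in auto)
next
  fix U assume U: "openin (seminorm_topology Y P) U"
  then have UY: "U \<subseteq> Y" unfolding openin_seminorm_topology by blast
  \<comment> \<open>The largest open set of the big space whose trace on \<open>Y\<close> stays
    inside \<open>U\<close>; taking it avoids choosing a ball for each point.\<close>
  define W where "W = \<Union> {B. openin \<tau> B \<and> B \<inter> Y \<subseteq> U}"
  have "U \<subseteq> W"
  proof
    fix x assume x: "x \<in> U"
    then obtain F \<epsilon> where F: "finite F" "F \<subseteq> P" "0 < \<epsilon>" "{y\<in>Y. \<forall>q\<in>F. q (y - x) < \<epsilon>} \<subseteq> U"
      using U unfolding openin_seminorm_topology by blast
    have xX: "x \<in> X" using x UY assms(2) by blast
    let ?B = "{y\<in>X. \<forall>q\<in>F. q (y - x) < \<epsilon>}"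
    have "openin \<tau> ?B" using openin_ball F(1-3) xX by blast
    moreover have "?B \<inter> Y \<subseteq> U" using F(4) by blast
    moreover have "q (x - x) < \<epsilon>" if "q \<in> F" for q
      using seminorm_zero[of q] F(2,3) that by auto
    then have "x \<in> ?B" using xX by blast
    ultimately show "x \<in> W" unfolding W_def by blast
  qed
  then have "U = W \<inter> Y" using UY unfolding W_def by blast
  moreover have "openin \<tau> W" unfolding W_def by (rule openin_Union) blast
  ultimately show "openin (subtopology \<tau> Y) U" unfolding openin_subtopology by blast
qed

text \<open>These are the hypotheses on the initial space. They form the invariant that is carried
  from level to level in both directions.\<close>

locale sobolev_level = lcs sc X "p ` \<Gamma>"
  for sc :: "'k::real_normed_field \<Rightarrow> 'a::ab_group_add \<Rightarrow> 'a" and X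
    and p :: "'g \<Rightarrow> 'a \<Rightarrow> real" and \<Gamma> +
  fixes T :: "real \<Rightarrow> 'a \<Rightarrow> 'a"
  assumes Hausdorff: "Hausdorff_space \<tau>"
    and complete: "complete_tvs X \<tau>"
    and semigroup: "sc_ee_semigroup sc X \<tau> T"
    and bij_generator: "bij_betw (generator sc \<tau> T) (generator_domain sc X \<tau> T) X"
    and continuous_inv_generator:
      "continuous_map \<tau> \<tau> (inv_into (generator_domain sc X \<tau> T) (generator sc \<tau> T))"

text \<open>The target carries the topology of the seminorms \<open>p'\<close>, so an injective
  linear isometry is automatically a homeomorphism onto its image. It is applied to \<open>R\<close>
  (upwards), to the extension of \<open>A\<close> (downwards), to the identification
  \<open>j\<close> and to the embeddings of the realisation.\<close>

lemma sobolev_level_transport: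
  assumes "sobolev_level sc X p \<Gamma> T" "vector_space sc'" "linear_map_on sc sc' X e" "inj_on e X"
    and p': "\<And>\<gamma> x. \<gamma> \<in> \<Gamma> \<Longrightarrow> x \<in> X \<Longrightarrow> p' \<gamma> (e x) = p \<gamma> x"
    and T': "\<And>t x. 0 \<le> t \<Longrightarrow> x \<in> X \<Longrightarrow> T' t (e x) = e (T t x)"
  shows "linear_homeomorphism sc sc' X (seminorm_topology X (p ` \<Gamma>)) (e ` X) (seminorm_topology (e ` X) (p' ` \<Gamma>)) e"
    and "sobolev_level sc' (e ` X) p' \<Gamma> T'"
proof -
  interpret sobolev_level sc X p \<Gamma> T by fact
  interpret cod: vector_space sc' by fact
  let ?\<sigma> = "seminorm_topology (e ` X) (p' ` \<Gamma>)"
  have "homeomorphic_map \<tau> ?\<sigma> e"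
    using assms(2-4) p' by (intro isometry_homeomorphic_map[OF vector_space_axioms _ subspace_X])
  with assms(3) show hom: "linear_homeomorphism sc sc' X \<tau> (e ` X) ?\<sigma> e"
    by unfold_locales (auto simp: subspace_X)
  interpret e: linear_homeomorphism sc sc' X \<tau> "e ` X" ?\<sigma> e by (rule hom)
  show "sobolev_level sc' (e ` X) p' \<Gamma> T'"
  proof
    fix q assume "q \<in> p' ` \<Gamma>"
    then obtain \<gamma> where \<gamma>: "\<gamma> \<in> \<Gamma>" "q = p' \<gamma>" by blast
    have "p \<gamma> \<in> p ` \<Gamma>" using \<gamma> by blast
    note s = seminorm_nonneg[OF this] seminorm_triangle[OF this] seminorm_scale[OF this]
    show "seminorm_on sc' (e ` X) q"
      unfolding seminorm_on_def
      using s by (auto simp: \<gamma> p' X_closed simp flip: e.e_add e.e_scale)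
  next
    show "cod.subspace (e ` X)" by (rule e.subspace_X')
    show "Hausdorff_space ?\<sigma>" by (rule e.Hausdorff_image[OF Hausdorff])
    show "complete_tvs (e ` X) ?\<sigma>" by (rule e.complete_image[OF complete])
    show "sc_ee_semigroup sc' (e ` X) ?\<sigma> T'" by (rule e.semigroup_image[OF semigroup T'])
    show "bij_betw (generator sc' ?\<sigma> T') (generator_domain sc' (e ` X) ?\<sigma> T') (e ` X)"
      "continuous_map ?\<sigma> ?\<sigma> (inv_into (generator_domain sc' (e ` X) ?\<sigma> T') (generator sc' ?\<sigma> T'))"
      using e.inv_generator_image[OF semigroup T' Hausdorff bij_generator continuous_inv_generator] by blast+
  qed
qed

section \<open>Algebra of the generator and its inverse\<close>

context sobolev_level
begin

abbreviation D where "D \<equiv> generator_domain sc X \<tau> T"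
abbreviation A where "A \<equiv> generator sc \<tau> T"
definition R where "R = inv_into D A"

lemma locally_convex: "locally_convex_space sc X \<tau>"
  unfolding locally_convex_space_def using subspace_X seminorm_P by blast

lemma T_mem: "0 \<le> t \<Longrightarrow> x \<in> X \<Longrightarrow> T t x \<in> X"
  and T_linear: "0 \<le> t \<Longrightarrow> linear_map_on sc sc X (T t)"
  and T_continuous: "0 \<le> t \<Longrightarrow> continuous_map \<tau> \<tau> (T t)"
  and T_semigroup: "0 \<le> t \<Longrightarrow> 0 \<le> s \<Longrightarrow> x \<in> X \<Longrightarrow> T (t + s) x = T t (T s x)"
  using semigroup continuous_map_image_subset_topspace[of \<tau> \<tau>]
  unfolding sc_ee_semigroup_def by (auto simp: image_subset_iff)

lemmas T_add = linear_map_on_add[OF T_linear]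
  and T_scale = linear_map_on_scale[OF T_linear]
  and T_diff = linear_map_on_diff[OF vector_space_axioms T_linear subspace_X]

lemma D_subset: "D \<subseteq> X" by (auto simp: generator_domain_def)

lemma A_mem: "x \<in> D \<Longrightarrow> A x \<in> X"
  using bij_generator by (auto simp: bij_betw_def)

lemma R_mem: "x \<in> X \<Longrightarrow> R x \<in> D" and A_R [simp]: "x \<in> X \<Longrightarrow> A (R x) = x"
  and R_A [simp]: "x \<in> D \<Longrightarrow> R (A x) = x"
  using bij_generator unfolding R_def
  by (auto simp: bij_betw_def inv_into_into f_inv_into_f)

lemma R_mem_X: "x \<in> X \<Longrightarrow> R x \<in> X" using R_mem D_subset by blast

lemma R_image: "R ` X = D"
proof (intro equalityI subsetI)
  fix x assume "x \<in> D"
  then show "x \<in> R ` X" using image_eqI[of x R "A x"] A_mem by simp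
qed (auto intro: R_mem)

lemma R_inj: "inj_on R X"
  by (rule inj_on_inverseI[where g = A]) (rule A_R)

lemma R_continuous: "continuous_map \<tau> \<tau> R"
  using continuous_inv_generator by (simp add: R_def)

lemma A_limit: "x \<in> D \<Longrightarrow> limitin \<tau> (difference_quotient sc T x) (A x) (at_right 0)"
  by (rule generator_limit[OF Hausdorff])

lemma generatorI:
  assumes "x \<in> X" "limitin \<tau> (difference_quotient sc T x) y (at_right 0)"
  shows "x \<in> D" "A x = y"
  using assms generator_eqI[OF Hausdorff] by (auto simp: generator_domain_def)

lemma at_right_0_pos: "\<forall>\<^sub>F t in at_right 0. 0 < (t::real)"
  by (simp add: eventually_at_right_less)

lemma
  assumes "x \<in> D" "y \<in> D"
  shows D_add: "x + y \<in> D" and A_add: "A (x + y) = A x + A y"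
proof -
  have X: "x \<in> X" "y \<in> X" using assms D_subset by auto
  have "\<forall>\<^sub>F t in at_right 0. difference_quotient sc T x t + difference_quotient sc T y t
      = difference_quotient sc T (x + y) t"
    using at_right_0_pos
    by eventually_elim (simp add: T_add X add_diff_add scale_right_distrib)
  from limitin_transform_eventually[OF this limitin_add[OF A_limit A_limit]]
  have "limitin \<tau> (difference_quotient sc T (x + y)) (A x + A y) (at_right 0)" using assms by blast
  with X X_closed show "x + y \<in> D" "A (x + y) = A x + A y" by (auto intro: generatorI)
qed

lemma
  assumes "x \<in> D"
  shows D_scale: "sc c x \<in> D" and A_scale: "A (sc c x) = sc c (A x)"
proof -
  have X: "x \<in> X" using assms D_subset by auto
  have "\<forall>\<^sub>F t in at_right 0. sc c (difference_quotient sc T x t) = difference_quotient sc T (sc c x) t"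
    using at_right_0_pos
    by eventually_elim (simp add: T_scale X mult.commute flip: scale_right_diff_distrib)
  from limitin_transform_eventually[OF this limitin_scale[OF A_limit[OF assms]]]
  have "limitin \<tau> (difference_quotient sc T (sc c x)) (sc c (A x)) (at_right 0)" .
  with X X_closed show "sc c x \<in> D" "A (sc c x) = sc c (A x)" by (auto intro: generatorI)
qed

text \<open>\<open>T s\<close> commutes with the difference quotients since
  \<open>s + t = t + s\<close>, and its continuity lets it pass through the limit. This yields that
  \<open>R\<close> commutes with the semigroup.\<close>

lemma
  assumes "x \<in> D" "0 \<le> s"
  shows T_D: "T s x \<in> D" and A_T: "A (T s x) = T s (A x)"
proof -
  have X: "x \<in> X" using assms D_subset by auto
  have "\<forall>\<^sub>F t in at_right 0. T s (difference_quotient sc T x t) = difference_quotient sc T (T s x) t"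
    using at_right_0_pos
  proof eventually_elim
    case (elim t)
    have "T t (T s x) = T s (T t x)"
      using T_semigroup[of t s x] T_semigroup[of s t x] assms(2) elim X by (simp add: add.commute)
    then show ?case using elim assms(2) X by (simp add: T_scale T_diff T_mem X_closed)
  qed
  from limitin_transform_eventually[OF this]
  have "limitin \<tau> (difference_quotient sc T (T s x)) (T s (A x)) (at_right 0)"
    using continuous_map_limit[OF T_continuous[OF assms(2)] A_limit[OF assms(1)]] by (simp add: o_def)
  with X assms(2) show "T s x \<in> D" "A (T s x) = T s (A x)" by (auto intro: generatorI T_mem)
qed

lemma subspace_D: "subspace D"
proof (rule subspaceI)
  obtain x where "x \<in> D" using R_mem X_closed(1) by blast
  then show "0 \<in> D" using D_scale[of x 0] by simp
qed (auto intro: D_add D_scale)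

lemma A_linear: "linear_map_on sc sc D A"
  by (simp add: linear_map_on_def A_add A_scale)

lemma R_linear: "linear_map_on sc sc X R"
  unfolding linear_map_on_def
proof (intro conjI ballI allI)
  fix x y assume "x \<in> X" "y \<in> X"
  then have "A (R x + R y) = x + y" "R x + R y \<in> D" by (simp_all add: A_add D_add R_mem)
  then show "R (x + y) = R x + R y" by (metis R_A)
next
  fix c x assume "x \<in> X"
  then have "A (sc c (R x)) = sc c x" "sc c (R x) \<in> D" by (simp_all add: A_scale D_scale R_mem)
  then show "R (sc c x) = sc c (R x)" by (metis R_A)
qed

lemma R_T: "0 \<le> t \<Longrightarrow> x \<in> X \<Longrightarrow> R (T t x) = T t (R x)"
  by (metis A_R A_T R_A R_mem T_D)

text \<open>Since \<open>A\<close> is onto, every \<open>x\<close> is the limit of the difference quotients of \<open>R x\<close>, which lie in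
  \<open>D\<close>; no integral over the orbit is needed.\<close>
lemma D_dense: "\<tau> closure_of D = X"
proof
  show "\<tau> closure_of D \<subseteq> X" using closure_of_subset_topspace[of \<tau>] by simp
  show "X \<subseteq> \<tau> closure_of D"
  proof
    fix x assume x: "x \<in> X"
    have lim: "limitin \<tau> (difference_quotient sc T (R x)) x (at_right 0)"
      using A_limit[OF R_mem[OF x]] x by simp
    have "\<forall>\<^sub>F t in at_right 0. difference_quotient sc T (R x) t \<in> D"
      using at_right_0_pos
      by eventually_elim (simp add: D_scale subspace_diff[OF subspace_D] T_D R_mem x)
    then have "\<forall>\<^sub>F t in at_right 0. difference_quotient sc T (R x) t \<in> \<tau> closure_of D"
      by (rule eventually_mono) (use closure_of_subset[of D \<tau>] D_subset in auto)
    then show "x \<in> \<tau> closure_of D"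
      using limitin_closedin[OF lim closedin_closure_of] trivial_limit_at_right_real by blast
  qed
qed

end

section \<open>One step of the tower\<close>

text \<open>Two neighbouring levels, with \<open>X\<close> the lower and \<open>X1\<close> the upper
  one. In the upward recursion these equations are the definition, in the downward recursion they
  have to be proved; all relations between the two levels are then derived from them, regardless of
  the sign of the index.\<close>

locale sobolev_step = sobolev_level sc X p \<Gamma> T
  for sc :: "'k::real_normed_field \<Rightarrow> 'a::ab_group_add \<Rightarrow> 'a" and X
    and p :: "'g \<Rightarrow> 'a \<Rightarrow> real" and \<Gamma> and T +
  fixes X1 :: "'a set" and p1 :: "'g \<Rightarrow> 'a \<Rightarrow> real" and T1 :: "real \<Rightarrow> 'a \<Rightarrow> 'a"
  assumes X1: "X1 = D"
    and p1: "\<gamma> \<in> \<Gamma> \<Longrightarrow> x \<in> X1 \<Longrightarrow> p1 \<gamma> x = p \<gamma> (A x)"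
    and T1: "0 \<le> t \<Longrightarrow> x \<in> X1 \<Longrightarrow> T1 t x = T t x"
begin

abbreviation \<tau>1 where "\<tau>1 \<equiv> seminorm_topology X1 (p1 ` \<Gamma>)"

lemma p1_R: "\<gamma> \<in> \<Gamma> \<Longrightarrow> x \<in> X \<Longrightarrow> p1 \<gamma> (R x) = p \<gamma> x"
  by (simp add: X1 p1 R_mem)

lemma T1_R: "0 \<le> t \<Longrightarrow> x \<in> X \<Longrightarrow> T1 t (R x) = R (T t x)"
  by (simp add: X1 T1 R_mem R_T)

lemma R_image1: "R ` X = X1"
  by (simp add: X1 R_image)

lemma R_homeomorphism: "linear_homeomorphism sc sc X \<tau> X1 \<tau>1 R"
  and upper_level: "sobolev_level sc X1 p1 \<Gamma> T1"
  by (rule sobolev_level_transport[where e = R and p' = p1 and T' = T1,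
        OF sobolev_level_axioms vector_space_axioms R_linear R_inj p1_R T1_R, unfolded R_image1]; assumption)+

end

sublocale sobolev_step \<subseteq> upper: sobolev_level sc X1 p1 \<Gamma> T1
  by (rule upper_level)

sublocale sobolev_step \<subseteq> R: linear_homeomorphism sc sc X \<tau> X1 upper.\<tau> R
  by (rule R_homeomorphism)

context sobolev_step
begin

lemma R_inv: "x \<in> X1 \<Longrightarrow> R.e_inv x = A x"
  using R.e_inv[of "A x"] by (simp add: X1 A_mem)

lemma A_homeomorphic: "homeomorphic_map \<tau>1 \<tau> A"
proof -
  have "homeomorphic_map \<tau>1 \<tau> R.e_inv"
    using R.homeo_maps by (simp add: homeomorphic_maps_map)
  then show ?thesis by (rule homeomorphic_map_eq) (simp add: R_inv)
qed

lemma X1_subset: "X1 \<subseteq> X" by (simp add: X1 D_subset)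

lemma X1_dense: "\<tau> closure_of X1 = X" by (simp add: X1 D_dense)

text \<open>On \<open>X1\<close> the inclusion is \<open>R\<close> after \<open>A\<close>: a
  homeomorphism onto \<open>X\<close> followed by the inverse of the generator, which is continuous
  on \<open>X\<close>.\<close>

lemma inclusion_continuous: "continuous_map \<tau>1 \<tau> (\<lambda>x. x)"
proof -
  have "continuous_map \<tau>1 \<tau> (R \<circ> A)"
    using homeomorphic_imp_continuous_map[OF A_homeomorphic] R_continuous
    by (rule continuous_map_compose)
  then show ?thesis by (rule continuous_map_eq) (simp add: X1)
qed

text \<open>The image of \<open>D\<close> under \<open>R\<close> is the domain of the square of
  \<open>A\<close>.\<close>

lemma upper_D: "upper.D = R ` D"
  by (rule R.generator_domain_image[OF semigroup T1_R])

text \<open>For \<open>x = R d\<close> with \<open>d \<in> D\<close>, the transported generator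
  gives \<open>R (A d) = d\<close>, and \<open>d\<close> is also \<open>A (R d)\<close>.\<close>

lemma upper_A: "x \<in> upper.D \<Longrightarrow> upper.A x = A x"
  using R.generator_image[OF semigroup T1_R Hausdorff] D_subset by (auto simp: upper_D)

lemma \<tau>1_eq: "\<tau>1 = seminorm_topology X1 ((\<lambda>\<gamma> x. p \<gamma> (A x)) ` \<Gamma>)"
  by (rule seminorm_topology_image_cong[OF vector_space_axioms upper.subspace_X p1])

text \<open>Since the upper generator restricts \<open>A\<close>, the operators cancel. So the
  seminorms used for completing \<open>X1\<close> are just \<open>p\<close> on \<open>X1\<close>;
  they induce the subspace topology, and the complete space \<open>X\<close>, in which
  \<open>X1\<close> is dense, is a completion.\<close>

lemma p1_upper_R: "\<gamma> \<in> \<Gamma> \<Longrightarrow> x \<in> X1 \<Longrightarrow> p1 \<gamma> (upper.R x) = p \<gamma> x"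
  using upper_A[of "upper.R x"] upper.D_subset by (auto simp: p1 upper.R_mem subset_iff)

lemma completion:
  "is_completion sc X1 (seminorm_topology X1 ((\<lambda>\<gamma> x. p1 \<gamma> (upper.R x)) ` \<Gamma>)) X \<tau>"
proof -
  have "seminorm_topology X1 ((\<lambda>\<gamma> x. p1 \<gamma> (upper.R x)) ` \<Gamma>) = seminorm_topology X1 (p ` \<Gamma>)"
    by (rule seminorm_topology_image_cong[OF vector_space_axioms upper.subspace_X p1_upper_R])
  then show ?thesis
    unfolding is_completion_def
    using locally_convex Hausdorff complete X1_subset X1_dense
      subtopology_subspace[OF upper.subspace_X X1_subset] by simp
qed

lemma seminorm_extension:
  assumes "\<gamma> \<in> \<Gamma>"
  shows "unique_continuous_extension \<tau> euclideanreal X1 (\<lambda>x. p1 \<gamma> (upper.R x)) (p \<gamma>)"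
  using assms X1_dense
  by (intro unique_continuous_extensionI continuous_map_seminorm)
     (auto simp: p1_upper_R Hausdorff_space_euclidean)

lemma semigroup_extension:
  assumes "0 \<le> t" shows "unique_continuous_extension \<tau> \<tau> X1 (T1 t) (T t)"
  using assms X1_dense Hausdorff
  by (intro unique_continuous_extensionI T_continuous) (auto simp: T1)

lemma generator_extension: "unique_continuous_extension \<tau>1 \<tau> upper.D upper.A A"
  using upper.D_dense Hausdorff homeomorphic_imp_continuous_map[OF A_homeomorphic]
  by (intro unique_continuous_extensionI) (auto simp: upper_A)

end

text \<open>Here \<sigma>, \<open>p'\<close> and \<open>T'\<close> are known only through the
  completion and through continuous extensions. The extensions \<open>e\<close> of \<open>A\<close>
  and \<open>r\<close> of \<open>R\<close> are mutually inverse, which gives the formulas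
  \<open>p' \<gamma> y = p \<gamma> (r y)\<close> and \<open>T' t y = e (T t (r y))\<close>; from
  there on \<open>Y\<close> is a copy of \<open>X\<close>.\<close>

lemma (in sobolev_level) step_down:
  assumes q: "\<And>\<gamma> x. \<gamma> \<in> \<Gamma> \<Longrightarrow> x \<in> X \<Longrightarrow> q \<gamma> x = p \<gamma> (R x)"
    and compl: "is_completion sc X (seminorm_topology X (q ` \<Gamma>)) Y \<sigma>"
    and p': "\<And>\<gamma> y. \<gamma> \<in> \<Gamma> \<Longrightarrow> y \<in> Y \<Longrightarrow> p' \<gamma> y = continuous_extension \<sigma> euclideanreal X (q \<gamma>) y"
    and T': "\<And>t y. 0 \<le> t \<Longrightarrow> y \<in> Y \<Longrightarrow> T' t y = continuous_extension \<sigma> \<sigma> X (T t) y"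
  shows "\<sigma> = seminorm_topology Y (p' ` \<Gamma>)" and "sobolev_step sc Y p' \<Gamma> T' X p T"
proof -
  \<comment> \<open>A completion comes with some defining family of seminorms. \<open>Q\<close> is a
    provisional one that makes the extension lemma applicable before the \<open>p' \<gamma>\<close>
    are known to define \<sigma>.\<close>
  obtain Q where \<sigma>: "\<sigma> = seminorm_topology Y Q" and lcsY: "lcs sc Y Q"
    using compl vector_space_axioms
    unfolding is_completion_def locally_convex_space_def lcs_def lcs_axioms_def by blast
  have Y: "Hausdorff_space \<sigma>" "complete_tvs Y \<sigma>" "X \<subseteq> Y" "\<sigma> closure_of X = Y"
    "subtopology \<sigma> X = seminorm_topology X (q ` \<Gamma>)" "topspace \<sigma> = Y"
    using compl unfolding is_completion_def \<sigma> by auto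
  let ?\<tau>D = "seminorm_topology D (p ` \<Gamma>)" and ?\<tau>q = "seminorm_topology X (q ` \<Gamma>)"
  have \<tau>D: "subtopology \<tau> D = ?\<tau>D" by (rule subtopology_subspace[OF subspace_D D_subset])
  \<comment> \<open>Since \<open>q \<gamma> (A x) = p \<gamma> (R (A x)) = p \<gamma> x\<close> on
    \<open>D\<close>, the generator is an isometry from \<open>D\<close>, with the topology of the
    present level, onto \<open>X\<close> with the topology to be completed.\<close>
  have "homeomorphic_map ?\<tau>D (seminorm_topology (A ` D) (q ` \<Gamma>)) A"
    using bij_generator A_mem
    by (intro isometry_homeomorphic_map[OF vector_space_axioms vector_space_axioms subspace_D A_linear])
      (auto simp: q bij_betw_def)
  then have "continuous_map (subtopology \<tau> D) (subtopology \<sigma> X) A"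
    using bij_generator unfolding \<tau>D Y(5)
    by (simp add: bij_betw_def homeomorphic_imp_continuous_map)
  then have A_cont: "continuous_map (subtopology \<tau> D) \<sigma> A"
    by (simp add: continuous_map_in_subtopology)
  obtain e where e: "continuous_map \<tau> \<sigma> e" "linear_map_on sc sc X e" "\<And>x. x \<in> D \<Longrightarrow> e x = A x"
    using continuous_linear_extension[OF lcs_axioms lcsY Y(1,2)[unfolded \<sigma>] subspace_D D_subset D_dense
        A_linear A_cont[unfolded \<sigma>]] unfolding \<sigma> by metis
  have "homeomorphic_map ?\<tau>q (seminorm_topology (R ` X) (p ` \<Gamma>)) R"
    by (intro isometry_homeomorphic_map[OF vector_space_axioms vector_space_axioms subspace_X R_linear R_inj])
      (simp add: q)
  then have "continuous_map (subtopology \<sigma> X) (subtopology \<tau> D) R"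
    unfolding \<tau>D Y(5) R_image by (rule homeomorphic_imp_continuous_map)
  then have R_cont: "continuous_map (subtopology \<sigma> X) \<tau> R"
    by (simp add: continuous_map_in_subtopology)
  obtain r where r: "continuous_map \<sigma> \<tau> r" "\<And>x. x \<in> X \<Longrightarrow> r x = R x"
    using continuous_linear_extension[OF lcsY lcs_axioms Hausdorff complete subspace_X Y(3) Y(4)[unfolded \<sigma>]
        R_linear R_cont[unfolded \<sigma>]] unfolding \<sigma> by metis
  have e_mem: "e x \<in> Y" if "x \<in> X" for x
    using continuous_map_image_subset_topspace[OF e(1)] Y(6) that by auto
  have r_mem: "r y \<in> X" if "y \<in> Y" for y
    using continuous_map_image_subset_topspace[OF r(1)] Y(6) that by auto
  have eR: "e (R x) = x" if "x \<in> X" for x using that e(3) by (simp add: R_mem)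
  have re: "r (e x) = x" if "x \<in> X" for x
  proof -
    have "x \<in> \<tau> closure_of D" using that D_dense by simp
    moreover have "continuous_map \<tau> \<tau> (\<lambda>x. r (e x))"
      using continuous_map_compose[OF e(1) r(1)] by (simp add: o_def)
    moreover have "continuous_map \<tau> \<tau> (\<lambda>x. x)" by simp
    moreover have "r (e x) = x" if "x \<in> D" for x using that by (simp add: e(3) r(2) A_mem)
    ultimately show ?thesis by (rule forall_in_closure_of_eq[OF _ Hausdorff])
  qed
  have er: "e (r y) = y" if "y \<in> Y" for y
  proof -
    have "y \<in> \<sigma> closure_of X" using that Y(4) by simp
    moreover have "continuous_map \<sigma> \<sigma> (\<lambda>x. e (r x))"
      using continuous_map_compose[OF r(1) e(1)] by (simp add: o_def)
    moreover have "continuous_map \<sigma> \<sigma> (\<lambda>x. x)" by simp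
    moreover have "e (r x) = x" if "x \<in> X" for x using that by (simp add: r(2) eR)
    ultimately show ?thesis by (rule forall_in_closure_of_eq[OF _ Y(1)])
  qed
  have e_image: "e ` X = Y" using e_mem r_mem er by (metis image_eqI subsetI subset_antisym image_subset_iff)
  have e_inj: "inj_on e X" by (rule inj_on_inverseI[where g = r]) (rule re)
  \<comment> \<open>On \<open>X\<close> the map \<open>r\<close> is \<open>R\<close>, so the
    right-hand side is a continuous extension of \<open>q \<gamma>\<close>; uniqueness evaluates the
    definite description.\<close>
  have p'_eq: "p' \<gamma> y = p \<gamma> (r y)" if "\<gamma> \<in> \<Gamma>" "y \<in> Y" for \<gamma> y
  proof -
    have "continuous_map \<sigma> euclideanreal (\<lambda>y. p \<gamma> (r y))"
      using continuous_map_compose[OF r(1) continuous_map_seminorm[of "p \<gamma>"]] that(1) by (simp add: o_def)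
    then have "unique_continuous_extension \<sigma> euclideanreal X (q \<gamma>) (\<lambda>y. p \<gamma> (r y))"
      using that(1) Y(4,6) by (intro unique_continuous_extensionI) (auto simp: q r(2) Hausdorff_space_euclidean)
    then show ?thesis
      using continuous_extension_eq p'[OF that] that(2) Y(3,6) by metis
  qed
  \<comment> \<open>The right-hand side extends \<open>T t\<close>: for \<open>y \<in> X\<close> it
    equals \<open>e (T t (R y)) = e (R (T t y)) = T t y\<close>.\<close>
  have T'_eq: "T' t y = e (T t (r y))" if "0 \<le> t" "y \<in> Y" for t y
  proof -
    have "continuous_map \<sigma> \<sigma> (\<lambda>y. e (T t (r y)))"
      using continuous_map_compose[OF continuous_map_compose[OF r(1) T_continuous[OF that(1)]] e(1)]
      by (simp add: o_def)
    moreover have "e (T t (r y)) = T t y" if "y \<in> X" for y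
      using \<open>0 \<le> t\<close> that by (simp add: r(2) eR T_mem flip: R_T)
    ultimately have "unique_continuous_extension \<sigma> \<sigma> X (T t) (\<lambda>y. e (T t (r y)))"
      using Y(1,4,6) by (intro unique_continuous_extensionI) auto
    then show ?thesis
      using continuous_extension_eq T'[OF that] that(2) Y(3,6) by metis
  qed
  have p'_e: "p' \<gamma> (e x) = p \<gamma> x" if "\<gamma> \<in> \<Gamma>" "x \<in> X" for \<gamma> x
    using that by (simp add: p'_eq e_mem re)
  have T'_e: "T' t (e x) = e (T t x)" if "0 \<le> t" "x \<in> X" for t x
    using that by (simp add: T'_eq e_mem re)
  let ?\<sigma>' = "seminorm_topology Y (p' ` \<Gamma>)"
  note tr = sobolev_level_transport[where e = e and p' = p' and T' = T', OF sobolev_level_axioms vector_space_axioms e(2) e_inj p'_e T'_e,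
      unfolded e_image]
  have hom: "linear_homeomorphism sc sc X \<tau> Y ?\<sigma>' e" and lev: "sobolev_level sc Y p' \<Gamma> T'"
    using tr by blast+
  interpret e: linear_homeomorphism sc sc X \<tau> Y ?\<sigma>' e by (rule hom)
  interpret Y: sobolev_level sc Y p' \<Gamma> T' by (rule lev)
  \<comment> \<open>\<open>e\<close> is a homeomorphism onto \<open>Y\<close> both for \<sigma> and
    for the topology of the \<open>p' \<gamma>\<close>, so these two topologies coincide.\<close>
  have "homeomorphic_map \<tau> \<sigma> e"
  proof -
    have "homeomorphic_maps \<tau> \<sigma> e r"
      using e(1) r(1) re er Y(6) by (simp add: homeomorphic_maps_def)
    then show ?thesis by (rule homeomorphic_maps_imp_map)
  qed
  then show "\<sigma> = ?\<sigma>'" using e.homeo homeomorphic_map_target_unique by blast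
  \<comment> \<open>Every \<open>x \<in> X\<close> is \<open>e (R x)\<close> with
    \<open>R x \<in> D\<close>. So \<open>e\<close> maps \<open>D\<close> onto \<open>X\<close>, and
    the transported generator sends \<open>x\<close> to \<open>e (A (R x)) = e x\<close>.\<close>
  have D_eq: "Y.D = X"
  proof -
    have "Y.D = e ` R ` X" using e.generator_domain_image[OF semigroup T'_e] R_image by simp
    also have "\<dots> = X" using eR by (simp add: image_image)
    finally show ?thesis .
  qed
  have A_eq: "Y.A x = e x" if "x \<in> X" for x
    using e.generator_image[OF semigroup T'_e Hausdorff R_mem[OF that]] that by (simp add: eR)
  show "sobolev_step sc Y p' \<Gamma> T' X p T"
  proof
    show "X = Y.D" by (simp add: D_eq)
    show "p \<gamma> x = p' \<gamma> (Y.A x)" if "\<gamma> \<in> \<Gamma>" "x \<in> X" for \<gamma> x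
      using that by (simp add: A_eq p'_e)
    show "T t x = T' t x" if t: "0 \<le> t" and x: "x \<in> X" for t x
      using T'_eq[of t x] t x Y(3) r(2) R_T[OF t x] eR[OF T_mem[OF t x]] by auto
  qed
qed

section \<open>The tower\<close>

text \<open>A two-sided chain without a distinguished level. Every claim about the tower concerns a
  level or its neighbours, so it is proved for all integers at once, including claims that hold by
  definition for one sign and need proof for the other.\<close>

locale sobolev_chain =
  fixes sc :: "'k::real_normed_field \<Rightarrow> 'a::ab_group_add \<Rightarrow> 'a" and X :: "int \<Rightarrow> 'a set"
    and p :: "int \<Rightarrow> 'g \<Rightarrow> 'a \<Rightarrow> real" and \<Gamma> :: "'g set" and T :: "int \<Rightarrow> real \<Rightarrow> 'a \<Rightarrow> 'a"
  assumes step: "sobolev_step sc (X n) (p n) \<Gamma> (T n) (X (n + 1)) (p (n + 1)) (T (n + 1))"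
begin

abbreviation \<tau> where "\<tau> n \<equiv> seminorm_topology (X n) (p n ` \<Gamma>)"
abbreviation D where "D n \<equiv> generator_domain sc (X n) (\<tau> n) (T n)"
abbreviation A where "A n \<equiv> generator sc (\<tau> n) (T n)"

lemma level: "sobolev_level sc (X n) (p n) \<Gamma> (T n)"
  by (rule sobolev_step.axioms(1)[OF step])

lemma D_eq: "D n = X (n + 1)"
  using sobolev_step.X1[OF step[of n]] by simp

lemma bij_generator: "bij_betw (A n) (D n) (X n)"
  by (rule sobolev_level.bij_generator[OF level])

lemma R_eq: "inv_into (D n) (A n) = sobolev_level.R sc (X n) (p n) \<Gamma> (T n)"
  by (rule sobolev_level.R_def[OF level, symmetric])

lemma tower_levels:
  "locally_convex_space sc (X n) (\<tau> n)" "Hausdorff_space (\<tau> n)" "complete_tvs (X n) (\<tau> n)"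
  "\<gamma> \<in> \<Gamma> \<Longrightarrow> seminorm_on sc (X n) (p n \<gamma>)" "sc_ee_semigroup sc (X n) (\<tau> n) (T n)"
proof -
  interpret L: sobolev_level sc "X n" "p n" \<Gamma> "T n" by (rule level)
  show "locally_convex_space sc (X n) (\<tau> n)" "Hausdorff_space (\<tau> n)" "complete_tvs (X n) (\<tau> n)"
    "sc_ee_semigroup sc (X n) (\<tau> n) (T n)"
    by (fact L.locally_convex L.Hausdorff L.complete L.semigroup)+
  show "\<gamma> \<in> \<Gamma> \<Longrightarrow> seminorm_on sc (X n) (p n \<gamma>)" by (rule L.seminorm_P) simp
qed

lemma tower_seminorm_extension:
  "\<gamma> \<in> \<Gamma> \<Longrightarrow> unique_continuous_extension (\<tau> n) euclideanreal (X (n + 1))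
     (\<lambda>x. p (n + 1) \<gamma> (inv_into (D (n + 1)) (A (n + 1)) x)) (p n \<gamma>)"
  unfolding R_eq by (rule sobolev_step.seminorm_extension[OF step])

lemma tower_inclusion:
  "X n \<subseteq> X (n - 1)" "\<tau> (n - 1) closure_of X n = X (n - 1)" "continuous_map (\<tau> n) (\<tau> (n - 1)) (\<lambda>x. x)"
  using sobolev_step.X1_subset[OF step[of "n - 1"]] sobolev_step.X1_dense[OF step[of "n - 1"]]
    sobolev_step.inclusion_continuous[OF step[of "n - 1"]] by simp_all

lemma tower_topology_lower: "\<tau> n = seminorm_topology (X n) ((\<lambda>\<gamma> x. p (n - 1) \<gamma> (A (n - 1) x)) ` \<Gamma>)"
  using sobolev_step.\<tau>1_eq[OF step[of "n - 1"]] by simp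

lemma tower_completion:
  "is_completion sc (X (n + 1)) (seminorm_topology (X (n + 1))
     ((\<lambda>\<gamma> x. p (n + 1) \<gamma> (inv_into (D (n + 1)) (A (n + 1)) x)) ` \<Gamma>)) (X n) (\<tau> n)"
  unfolding R_eq by (rule sobolev_step.completion[OF step])

lemma tower_semigroup:
  assumes "0 \<le> t"
  shows "x \<in> X n \<Longrightarrow> T n t x = T (n - 1) t x"
    and "unique_continuous_extension (\<tau> n) (\<tau> n) (X (n + 1)) (T (n + 1) t) (T n t)"
  using sobolev_step.T1[OF step[of "n - 1"]] sobolev_step.semigroup_extension[OF step[of n]] assms
  by simp_all

lemma tower_generator:
  "linear_map_on sc sc (X (n + 1)) (A n)"
  "homeomorphic_map (\<tau> (n + 1)) (\<tau> n) (A n)"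
  "x \<in> X (n + 1) \<Longrightarrow> A n x = A (n - 1) x"
  "unique_continuous_extension (\<tau> (n + 1)) (\<tau> n) (X (n + 2)) (A (n + 1)) (A n)"
proof -
  interpret S: sobolev_step sc "X n" "p n" \<Gamma> "T n" "X (n + 1)" "p (n + 1)" "T (n + 1)" by (rule step)
  show "linear_map_on sc sc (X (n + 1)) (A n)" using S.A_linear by (simp add: D_eq)
  show "homeomorphic_map (\<tau> (n + 1)) (\<tau> n) (A n)" by (rule S.A_homeomorphic)
  show "unique_continuous_extension (\<tau> (n + 1)) (\<tau> n) (X (n + 2)) (A (n + 1)) (A n)"
    using S.generator_extension D_eq[of "n + 1"] by (simp add: add.assoc)
  show "x \<in> X (n + 1) \<Longrightarrow> A n x = A (n - 1) x"
    using sobolev_step.upper_A[OF step[of "n - 1"], of x] D_eq[of n] by simp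
qed

text \<open>The converse direction, used for existence: a chain with a copy of the initial space at
  index 0 satisfies both recursions of the definition.\<close>

lemma sobolev_towerI:
  assumes "linear_map_on smul sc X0 j" "X 0 = j ` X0" "homeomorphic_map \<tau>0 (\<tau> 0) j"
    and "\<And>\<gamma> x. \<gamma> \<in> \<Gamma> \<Longrightarrow> x \<in> X0 \<Longrightarrow> p 0 \<gamma> (j x) = p0 \<gamma> x"
    and "\<And>t x. 0 \<le> t \<Longrightarrow> x \<in> X0 \<Longrightarrow> T 0 t (j x) = j (T0 t x)"
  shows "sobolev_tower smul X0 \<tau>0 \<Gamma> p0 T0 sc j X \<tau> p T D A"
  unfolding sobolev_tower_def Let_def
proof (intro conjI allI impI ballI)
  show "vector_space sc"
    using level[of 0] unfolding sobolev_level_def lcs_def by blast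
next
  fix n :: int
  note st = step[of "n - 1", simplified]
  show "X n = D (n - 1)" using D_eq[of "n - 1"] by simp
  show "p n \<gamma> x = p (n - 1) \<gamma> (A (n - 1) x)" if "\<gamma> \<in> \<Gamma>" "x \<in> X n" for \<gamma> x
    using sobolev_step.p1[OF st that] .
  show "T n t x = T (n - 1) t x" if "0 \<le> t" "x \<in> X n" for t x
    using tower_semigroup(1) that .
  have sub: "X (n + 1) \<subseteq> topspace (\<tau> n)" using tower_inclusion(1)[of "n + 1"] by simp
  show "p n \<gamma> x = continuous_extension (\<tau> n) euclideanreal (X (n + 1))
      (\<lambda>x. p (n + 1) \<gamma> (inv_into (D (n + 1)) (A (n + 1)) x)) x" if "\<gamma> \<in> \<Gamma>" "x \<in> X n" for \<gamma> x
    using continuous_extension_eq[OF tower_seminorm_extension[OF that(1)] _ sub] that(2) by simp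
  show "T n t x = continuous_extension (\<tau> n) (\<tau> n) (X (n + 1)) (T (n + 1) t) x"
    if "0 \<le> t" "x \<in> X n" for t x
    using continuous_extension_eq[OF tower_semigroup(2)[OF that(1)] _ sub] that(2) by simp
qed (use assms tower_completion in simp_all)

end

text \<open>Induction from 0 in both directions. The identity of \<open>\<tau> n\<close> with the
  seminorm topology belongs to the invariant, because the tower forms \<open>D n\<close>,
  \<open>A n\<close> and the inverse of \<open>A n\<close> with respect to
  \<open>\<tau> n\<close>.\<close>

lemma sobolev_tower_chain:
  assumes level0: "sobolev_level smul X0 p0 \<Gamma> T0"
    and \<tau>0: "\<tau>0 = seminorm_topology X0 (p0 ` \<Gamma>)"
    and tower: "sobolev_tower smul X0 \<tau>0 \<Gamma> p0 T0 sc j X \<tau> p T D A"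
  shows "sobolev_chain sc X p \<Gamma> T" and "\<tau> n = seminorm_topology (X n) (p n ` \<Gamma>)"
proof -
  let ?\<tau> = "\<lambda>n. seminorm_topology (X n) (p n ` \<Gamma>)"
  have vs: "vector_space sc" and D: "\<And>n. D n = generator_domain sc (X n) (\<tau> n) (T n)"
    and A: "\<And>n. A n = generator sc (\<tau> n) (T n)"
    and j: "linear_map_on smul sc X0 j" "X 0 = j ` X0" "homeomorphic_map \<tau>0 (\<tau> 0) j"
    and p0: "\<And>\<gamma> x. \<gamma> \<in> \<Gamma> \<Longrightarrow> x \<in> X0 \<Longrightarrow> p 0 \<gamma> (j x) = p0 \<gamma> x"
    and T0: "\<And>t x. 0 \<le> t \<Longrightarrow> x \<in> X0 \<Longrightarrow> T 0 t (j x) = j (T0 t x)"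
    using tower unfolding sobolev_tower_def by simp_all
  have up: "X n = D (n - 1)" "\<tau> n = ?\<tau> n"
    "\<And>\<gamma> x. \<gamma> \<in> \<Gamma> \<Longrightarrow> x \<in> X n \<Longrightarrow> p n \<gamma> x = p (n - 1) \<gamma> (A (n - 1) x)"
    "\<And>t x. 0 \<le> t \<Longrightarrow> x \<in> X n \<Longrightarrow> T n t x = T (n - 1) t x" if "1 \<le> n" for n
    using tower that unfolding sobolev_tower_def by simp_all
  let ?q = "\<lambda>n \<gamma> x. p (n + 1) \<gamma> (inv_into (D (n + 1)) (A (n + 1)) x)"
  have down: "is_completion sc (X (n + 1)) (seminorm_topology (X (n + 1)) (?q n ` \<Gamma>)) (X n) (\<tau> n)"
    "\<And>\<gamma> x. \<gamma> \<in> \<Gamma> \<Longrightarrow> x \<in> X n \<Longrightarrow> p n \<gamma> x = continuous_extension (\<tau> n) euclideanreal (X (n + 1)) (?q n \<gamma>) x"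
    "\<And>t x. 0 \<le> t \<Longrightarrow> x \<in> X n \<Longrightarrow> T n t x = continuous_extension (\<tau> n) (\<tau> n) (X (n + 1)) (T (n + 1) t) x"
    if "n \<le> -1" for n
    using tower[unfolded sobolev_tower_def Let_def, THEN conjunct2, THEN conjunct2, THEN conjunct2,
        THEN conjunct2, THEN conjunct2, THEN conjunct2, THEN conjunct2, THEN conjunct2, THEN conjunct2,
        THEN spec, THEN mp, OF that] by blast+
  let ?L = "\<lambda>n. sobolev_level sc (X n) (p n) \<Gamma> (T n)"
  let ?S = "\<lambda>n. sobolev_step sc (X n) (p n) \<Gamma> (T n) (X (n + 1)) (p (n + 1)) (T (n + 1))"
  \<comment> \<open>The definition asks only that \<open>j\<close> be a homeomorphism for
    \<open>\<tau> 0\<close>. Being isometric, \<open>j\<close> is also one for the seminorm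
    topology, so the two topologies agree.\<close>
  have base: "?L 0 \<and> \<tau> 0 = ?\<tau> 0"
  proof -
    interpret L: sobolev_level smul X0 p0 \<Gamma> T0 by (rule level0)
    have inj: "inj_on j X0" using homeomorphic_imp_injective_map[OF j(3)] by (simp add: \<tau>0)
    note tr = sobolev_level_transport[where e = j and p' = "p 0" and T' = "T 0",
        OF level0 vs j(1) inj p0 T0, folded j(2)]
    have "linear_homeomorphism smul sc X0 \<tau>0 (X 0) (?\<tau> 0) j" and lev: "?L 0"
      using tr unfolding \<tau>0 by blast+
    from homeomorphic_map_target_unique[OF j(3) linear_homeomorphism.homeo[OF this(1)]] lev
    show ?thesis by blast
  qed
  have step_up: "?S n" if "0 \<le> n" "?L n" "\<tau> n = ?\<tau> n" for n
  proof -
    interpret sobolev_level sc "X n" "p n" \<Gamma> "T n" by fact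
    show ?thesis
      using up[of "n + 1"] that(1) by unfold_locales (simp_all add: D A that(3))
  qed
  have step_down: "?S n \<and> \<tau> n = ?\<tau> n" if n: "n \<le> -1" and L: "?L (n + 1)" "\<tau> (n + 1) = ?\<tau> (n + 1)" for n
  proof -
    interpret L: sobolev_level sc "X (n + 1)" "p (n + 1)" \<Gamma> "T (n + 1)" by fact
    have q: "?q n \<gamma> x = p (n + 1) \<gamma> (L.R x)" for \<gamma> x by (simp add: L.R_def D A L(2))
    show ?thesis
      using L.step_down[where q = "?q n" and p' = "p n" and T' = "T n", OF q down[OF n]] by blast
  qed
  have pos: "?L n \<and> \<tau> n = ?\<tau> n" if "0 \<le> n" for n
    using that
  proof (induction n rule: int_ge_induct)
    case (step n)
    then show ?case
      using sobolev_step.upper_level[OF step_up[of n]] up(2)[of "n + 1"] by simp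
  qed (rule base)
  have neg: "?L n \<and> \<tau> n = ?\<tau> n" if "n \<le> 0" for n
    using that
  proof (induction n rule: int_le_induct)
    case (step n)
    then have "?S (n - 1) \<and> \<tau> (n - 1) = ?\<tau> (n - 1)" using step_down[of "n - 1"] by simp
    then show ?case by (blast intro: sobolev_step.axioms(1))
  qed (rule base)
  have lev: "?L n \<and> \<tau> n = ?\<tau> n" for n
    using pos[of n] neg[of n] by linarith
  show "\<tau> n = ?\<tau> n" using lev by blast
  show "sobolev_chain sc X p \<Gamma> T"
  proof (rule sobolev_chain.intro)
    fix n
    show "?S n"
      using step_up[of n] step_down[of n] lev by (cases "0 \<le> n") auto
  qed
qed

section \<open>Realisation in a direct limit\<close>

definition poly_mapping_scale :: "'k::comm_ring_1 \<Rightarrow> ('i \<Rightarrow>\<^sub>0 'k) \<Rightarrow> ('i \<Rightarrow>\<^sub>0 'k)" where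
  "poly_mapping_scale c = Poly_Mapping.map ((*) c)"

lemma lookup_poly_mapping_scale [simp]:
  "Poly_Mapping.lookup (poly_mapping_scale c f) i = c * Poly_Mapping.lookup f i"
  by (simp add: poly_mapping_scale_def Poly_Mapping.map.rep_eq when_def)

lemma vector_space_poly_mapping: "vector_space (poly_mapping_scale :: 'k::field \<Rightarrow> _)"
  by unfold_locales (auto intro!: poly_mapping_eqI simp: lookup_add algebra_simps)

text \<open>The linear map on the free vector space that takes the value \<open>\<phi> i\<close> at
  the basis vector \<open>i\<close>.\<close>

definition linear_extension :: "('k::field \<Rightarrow> 'a::ab_group_add \<Rightarrow> 'a) \<Rightarrow> ('i \<Rightarrow> 'a) \<Rightarrow> ('i \<Rightarrow>\<^sub>0 'k) \<Rightarrow> 'a" where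
  "linear_extension sc \<phi> f = (\<Sum>i\<in>Poly_Mapping.keys f. sc (Poly_Mapping.lookup f i) (\<phi> i))"

context vector_space
begin

lemma linear_extension_superset:
  assumes "finite S" "Poly_Mapping.keys f \<subseteq> S"
  shows "linear_extension scale \<phi> f = (\<Sum>i\<in>S. scale (Poly_Mapping.lookup f i) (\<phi> i))"
  unfolding linear_extension_def using assms
  by (intro sum.mono_neutral_left) (auto simp: in_keys_iff)

lemma linear_extension_add:
  "linear_extension scale \<phi> (f + g) = linear_extension scale \<phi> f + linear_extension scale \<phi> g"
proof -
  let ?S = "Poly_Mapping.keys f \<union> Poly_Mapping.keys g"
  have "linear_extension scale \<phi> (f + g) = (\<Sum>i\<in>?S. scale (Poly_Mapping.lookup (f + g) i) (\<phi> i))"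
    by (rule linear_extension_superset) (auto dest: subsetD[OF Poly_Mapping.keys_add])
  also have "\<dots> = (\<Sum>i\<in>?S. scale (Poly_Mapping.lookup f i) (\<phi> i)) + (\<Sum>i\<in>?S. scale (Poly_Mapping.lookup g i) (\<phi> i))"
    by (simp add: lookup_add scale_left_distrib sum.distrib)
  finally show ?thesis using linear_extension_superset[of ?S] by simp
qed

lemma linear_extension_scale:
  "linear_extension scale \<phi> (poly_mapping_scale c f) = scale c (linear_extension scale \<phi> f)"
proof -
  have "linear_extension scale \<phi> (poly_mapping_scale c f)
      = (\<Sum>i\<in>Poly_Mapping.keys f. scale (Poly_Mapping.lookup (poly_mapping_scale c f) i) (\<phi> i))"
    by (rule linear_extension_superset) (auto simp: in_keys_iff)
  then show ?thesis by (simp add: linear_extension_def scale_sum_right)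
qed

lemma linear_extension_single: "linear_extension scale \<phi> (Poly_Mapping.single i c) = scale c (\<phi> i)"
  by (simp add: linear_extension_def)

text \<open>A substitute for the quotient by \<open>K\<close> that stays in the same type:
  subtracting a linear projection \<open>g\<close> onto \<open>K\<close> leaves a map with kernel
  exactly \<open>K\<close>.\<close>

lemma exists_linear_with_kernel:
  assumes "subspace K"
  obtains \<pi> where "Vector_Spaces.linear scale scale \<pi>" "\<And>x. \<pi> x = 0 \<longleftrightarrow> x \<in> K"
proof -
  interpret VP: vector_space_pair scale scale by unfold_locales
  have "Vector_Spaces.linear scale scale (\<lambda>x. x)" by (rule linear_ident)
  from VP.linear_exists_left_inverse_on[OF this assms] obtain g where
    g: "g ` UNIV \<subseteq> K" "Vector_Spaces.linear scale scale g" "\<And>v. v \<in> K \<Longrightarrow> g v = v" by auto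
  show ?thesis
  proof
    show "Vector_Spaces.linear scale scale (\<lambda>x. x - g x)" by (rule VP.linear_compose_sub[OF linear_ident g(2)])
    show "x - g x = 0 \<longleftrightarrow> x \<in> K" for x using g(1,3) by (metis eq_iff_diff_eq_0 rangeI subsetD)
  qed
qed

text \<open>The direct limit of \<open>X \<rightarrow> X \<rightarrow> X \<rightarrow> \<dots>\<close> with all maps equal to \<open>R\<close>: the free vector space over
  \<open>\<nat> \<times> X\<close>, projected along the subspace of all \<open>f\<close> that vanish when pushed to a sufficiently late
  copy of \<open>X\<close>.\<close>
lemma exists_direct_limit:
  assumes X: "subspace X" and R: "linear_map_on scale scale X R" "inj_on R X" "\<And>x. x \<in> X \<Longrightarrow> R x \<in> X"
  obtains J :: "nat \<Rightarrow> 'b \<Rightarrow> (nat \<times> 'b \<Rightarrow>\<^sub>0 'a)" where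
    "\<And>m. linear_map_on scale poly_mapping_scale X (J m)" "\<And>m. inj_on (J m) X"
    "\<And>m x. x \<in> X \<Longrightarrow> J (Suc m) (R x) = J m x"
proof -
  interpret F: vector_space "poly_mapping_scale :: 'a \<Rightarrow> (nat \<times> 'b \<Rightarrow>\<^sub>0 'a) \<Rightarrow> _"
    by (rule vector_space_poly_mapping)
  let ?s = "\<lambda>m x. Poly_Mapping.single (m, x) (1::'a)"
  \<comment> \<open>\<open>\<Phi> N\<close> pushes all copies up to number \<open>N\<close> into
    copy \<open>N\<close>. Later copies, and basis vectors over elements outside \<open>X\<close>,
    are sent to 0 as a default.\<close>
  define \<Phi> where "\<Phi> N = linear_extension scale (\<lambda>(m, x). if m \<le> N \<and> x \<in> X then (R ^^ (N - m)) x else 0)"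
    for N :: nat
  have Rn: "(R ^^ n) x \<in> X" if "x \<in> X" for n x
    using that by (induction n) (auto simp: R(3))
  have Rn_linear: "(R ^^ n) (x + y) = (R ^^ n) x + (R ^^ n) y" "(R ^^ n) (scale c x) = scale c ((R ^^ n) x)"
    if "x \<in> X" "y \<in> X" for n c x y
    using that by (induction n)
      (simp_all add: linear_map_on_add[OF R(1)] linear_map_on_scale[OF R(1)] Rn)
  have Rn_zero: "x = 0" if "x \<in> X" "(R ^^ n) x = 0" for n x
    using that
  proof (induction n)
    case (Suc n)
    have "R ((R ^^ n) x) = R 0"
      using Suc.prems linear_map_on_zero[OF vector_space_axioms R(1) X] by simp
    then have "(R ^^ n) x = 0" using R(2) Rn[OF Suc.prems(1)] subspace_0[OF X] by (meson inj_onD)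
    then show ?case using Suc by simp
  qed simp
  have \<Phi>_add: "\<Phi> N (f + g) = \<Phi> N f + \<Phi> N g" and \<Phi>_scale: "\<Phi> N (poly_mapping_scale c f) = scale c (\<Phi> N f)"
    for N f g c
    by (simp_all add: \<Phi>_def linear_extension_add linear_extension_scale)
  have \<Phi>_diff: "\<Phi> N (f - g) = \<Phi> N f - \<Phi> N g" for N f g
    using \<Phi>_add[of N "f - g" g] by (simp add: algebra_simps)
  have \<Phi>_s: "\<Phi> N (?s m x) = (R ^^ (N - m)) x" if "m \<le> N" "x \<in> X" for N m x
    using that by (simp add: \<Phi>_def linear_extension_single)
  \<comment> \<open>Vanishing has to be eventual: for small \<open>N\<close> the cut-off in
    \<open>\<Phi> N\<close> kills vectors that are nonzero in the limit.\<close>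
  define K where "K = {f. \<forall>\<^sub>F N in sequentially. \<Phi> N f = 0}"
  have "F.subspace K"
  proof (rule F.subspaceI)
    show "0 \<in> K" using \<Phi>_diff[of _ 0 0] by (simp add: K_def)
    show "f + g \<in> K" if "f \<in> K" "g \<in> K" for f g
      using that unfolding K_def mem_Collect_eq by eventually_elim (simp add: \<Phi>_add)
    show "poly_mapping_scale c f \<in> K" if "f \<in> K" for c f
      using that unfolding K_def mem_Collect_eq by eventually_elim (simp add: \<Phi>_scale)
  qed
  then obtain \<pi> :: "(nat \<times> 'b \<Rightarrow>\<^sub>0 'a) \<Rightarrow> (nat \<times> 'b \<Rightarrow>\<^sub>0 'a)" where
    \<pi>: "Vector_Spaces.linear poly_mapping_scale poly_mapping_scale \<pi>" "\<And>x. \<pi> x = 0 \<longleftrightarrow> x \<in> K"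
    using F.exists_linear_with_kernel by blast
  interpret \<pi>: Vector_Spaces.linear poly_mapping_scale poly_mapping_scale \<pi> by (rule \<pi>(1))
  have \<pi>_eq: "\<pi> f = \<pi> g \<longleftrightarrow> (\<forall>\<^sub>F N in sequentially. \<Phi> N f = \<Phi> N g)" for f g
    using \<pi>(2)[of "f - g"] by (simp add: K_def \<pi>.diff \<Phi>_diff)
  have ev: "\<forall>\<^sub>F N in sequentially. m \<le> N" for m :: nat by (rule eventually_ge_at_top)
  show ?thesis
  proof
    fix m
    show "linear_map_on scale poly_mapping_scale X (\<lambda>x. \<pi> (?s m x))"
      unfolding linear_map_on_def
    proof (intro conjI ballI allI)
      fix x y assume xy: "x \<in> X" "y \<in> X"
      have "\<pi> (?s m (x + y)) = \<pi> (?s m x + ?s m y)"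
        unfolding \<pi>_eq
        by (rule eventually_mono[OF ev[of m]]) (simp add: xy \<Phi>_s \<Phi>_add Rn_linear subspace_add[OF X])
      then show "\<pi> (?s m (x + y)) = \<pi> (?s m x) + \<pi> (?s m y)" by (simp add: \<pi>.add)
    next
      fix c x assume x: "x \<in> X"
      have "\<pi> (?s m (scale c x)) = \<pi> (poly_mapping_scale c (?s m x))"
        unfolding \<pi>_eq
        by (rule eventually_mono[OF ev[of m]]) (simp add: x \<Phi>_s \<Phi>_scale Rn_linear[OF x x] subspace_scale[OF X])
      then show "\<pi> (?s m (scale c x)) = poly_mapping_scale c (\<pi> (?s m x))" by (simp add: \<pi>.scale)
    qed
    show "inj_on (\<lambda>x. \<pi> (?s m x)) X"
    proof (rule inj_onI)
      fix x y assume xy: "x \<in> X" "y \<in> X" "\<pi> (?s m x) = \<pi> (?s m y)"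
      then have "\<forall>\<^sub>F N in sequentially. m \<le> N \<and> \<Phi> N (?s m x) = \<Phi> N (?s m y)"
        using ev[of m] by (simp add: \<pi>_eq eventually_conj_iff)
      then obtain N where N: "m \<le> N" "\<Phi> N (?s m x) = \<Phi> N (?s m y)"
        by (auto dest: eventually_happens)
      then have "(R ^^ (N - m)) ((x - y) + y) = (R ^^ (N - m)) y" using xy by (simp add: \<Phi>_s)
      then have "(R ^^ (N - m)) (x - y) = 0"
        using Rn_linear(1)[of "x - y" y "N - m"] xy subspace_diff[OF X] by simp
      then show "x = y" using Rn_zero[of "x - y"] xy subspace_diff[OF X] by simp
    qed
    show "\<pi> (?s (Suc m) (R x)) = \<pi> (?s m x)" if "x \<in> X" for x
    proof -
      have "\<Phi> N (?s (Suc m) (R x)) = \<Phi> N (?s m x)" if "Suc m \<le> N" for N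
      proof -
        \<comment> \<open>Starting one copy later saves one application of \<open>R\<close>, which
          is the one already applied to \<open>x\<close>.\<close>
        have "N - m = Suc (N - Suc m)" using that by simp
        then show ?thesis
          using that \<open>x \<in> X\<close> by (simp add: \<Phi>_s R(3) funpow_swap1 del: diff_Suc_Suc)
      qed
      then show ?thesis
        unfolding \<pi>_eq by (rule eventually_mono[OF ev[of "Suc m"]])
    qed
  qed
qed

end

lemma (in sobolev_level) exists_sobolev_tower:
  "\<exists>(sc' :: 'k \<Rightarrow> (nat \<times> 'a \<Rightarrow>\<^sub>0 'k) \<Rightarrow> (nat \<times> 'a \<Rightarrow>\<^sub>0 'k)) j Y \<sigma> q S D' A'.
     sobolev_tower sc X \<tau> \<Gamma> p T sc' j Y \<sigma> q S D' A'"
proof -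
  obtain J :: "nat \<Rightarrow> 'a \<Rightarrow> (nat \<times> 'a \<Rightarrow>\<^sub>0 'k)" where
    J: "\<And>m. linear_map_on sc poly_mapping_scale X (J m)" "\<And>m. inj_on (J m) X"
      "\<And>m x. x \<in> X \<Longrightarrow> J (Suc m) (R x) = J m x"
    using exists_direct_limit[OF subspace_X R_linear R_inj R_mem_X] by blast
  have Rn: "(R ^^ n) x \<in> X" if "x \<in> X" for n x
    using that by (induction n) (auto simp: R_mem_X)
  have Rn_linear: "linear_map_on sc sc X (R ^^ n)" for n
    by (induction n) (simp_all add: linear_map_on_def linear_map_on_add[OF R_linear]
        linear_map_on_scale[OF R_linear] Rn)
  have Rn_inj: "inj_on (R ^^ n) X" for n
  proof (induction n)
    case (Suc n)
    have "inj_on R ((R ^^ n) ` X)" using R_inj Rn by (auto intro: inj_on_subset)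
    from comp_inj_on[OF Suc this] show ?case by (simp add: o_def)
  qed simp
  \<comment> \<open>Level \<open>- m\<close> is the copy number \<open>m\<close> of
    \<open>X\<close>. Positive levels need no new copy: they are images of powers of
    \<open>R\<close> inside copy 0.\<close>
  define E where "E n = (if n \<le> 0 then J (nat (- n)) else J 0 \<circ> (R ^^ nat n))" for n :: int
  have E_linear: "linear_map_on sc poly_mapping_scale X (E n)" for n
    using J(1) linear_map_on_add[OF Rn_linear] linear_map_on_scale[OF Rn_linear] Rn
    by (simp add: E_def linear_map_on_def)
  have E_inj: "inj_on (E n) X" for n
    using J(2) Rn by (auto simp: E_def intro!: comp_inj_on Rn_inj inj_on_subset[OF J(2)[of 0]])
  \<comment> \<open>This identity contains the whole nesting: \<open>Y (n + 1)\<close> lies in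
    \<open>Y n\<close> as the image of the range of \<open>R\<close>, that is, of the domain of the
    generator.\<close>
  have E_R: "E (n + 1) x = E n (R x)" if "x \<in> X" for n x
  proof (cases "n < 0")
    case True
    then have "nat (- n) = Suc (nat (- (n + 1)))" by simp
    then show ?thesis using True J(3)[OF that] by (simp add: E_def)
  next
    case False
    then have "nat (n + 1) = Suc (nat n)" by simp
    then show ?thesis using False by (auto simp: E_def funpow_swap1)
  qed
  define Y where "Y n = E n ` X" for n
  define q where "q n \<gamma> y = p \<gamma> (inv_into X (E n) y)" for n \<gamma> y
  define S where "S n t y = E n (T t (inv_into X (E n) y))" for n t y
  have q_E: "q n \<gamma> (E n x) = p \<gamma> x" and S_E: "S n t (E n x) = E n (T t x)" if "x \<in> X" for n \<gamma> t x
    using that E_inj by (simp_all add: q_def S_def)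
  note tr = sobolev_level_transport[where e = "E n" and p' = "q n" and T' = "S n" for n,
      OF sobolev_level_axioms vector_space_poly_mapping E_linear E_inj q_E S_E, folded Y_def]
  have hom: "linear_homeomorphism sc poly_mapping_scale X \<tau> (Y n) (seminorm_topology (Y n) (q n ` \<Gamma>)) (E n)"
    and lev: "sobolev_level poly_mapping_scale (Y n) (q n) \<Gamma> (S n)" for n
    using tr by blast+
  interpret chain: sobolev_chain poly_mapping_scale Y q \<Gamma> S
  proof (rule sobolev_chain.intro)
    fix n
    interpret E: linear_homeomorphism sc poly_mapping_scale X \<tau> "Y n" "seminorm_topology (Y n) (q n ` \<Gamma>)" "E n"
      by (rule hom)
    interpret Y: sobolev_level poly_mapping_scale "Y n" "q n" \<Gamma> "S n" by (rule lev)
    have Y1: "Y (n + 1) = E n ` R ` X" using E_R by (simp add: Y_def image_image)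
    \<comment> \<open>The generator of level \<open>n\<close> undoes \<open>R\<close> under the
      embedding \<open>E n\<close>; by \<open>E_R\<close> it maps the copy of \<open>x\<close> in
      level \<open>n + 1\<close> to the copy of \<open>x\<close> in level \<open>n\<close>.\<close>
    have A_E: "Y.A (E n (R x)) = E n x" if "x \<in> X" for x
      using E.generator_image[OF semigroup S_E Hausdorff R_mem[OF that]] that by simp
    show "sobolev_step poly_mapping_scale (Y n) (q n) \<Gamma> (S n) (Y (n + 1)) (q (n + 1)) (S (n + 1))"
    proof
      show "Y (n + 1) = Y.D"
        using E.generator_domain_image[OF semigroup S_E] by (simp add: Y1 R_image)
      show "q (n + 1) \<gamma> y = q n \<gamma> (Y.A y)" if "y \<in> Y (n + 1)" for \<gamma> y
      proof -
        obtain x where x: "x \<in> X" "y = E n (R x)" using \<open>y \<in> Y (n + 1)\<close> unfolding Y1 by blast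
        then have "q (n + 1) \<gamma> y = p \<gamma> x" using q_E[OF x(1), of "n + 1" \<gamma>] by (simp add: E_R)
        then show ?thesis using x by (simp add: A_E q_E)
      qed
      show "S (n + 1) t y = S n t y" if "0 \<le> t" "y \<in> Y (n + 1)" for t y
      proof -
        obtain x where x: "x \<in> X" "y = E n (R x)" using \<open>y \<in> Y (n + 1)\<close> unfolding Y1 by blast
        then have "S (n + 1) t y = E n (R (T t x))"
          using S_E[OF x(1), of "n + 1" t] \<open>0 \<le> t\<close> by (simp add: E_R T_mem)
        also have "\<dots> = S n t y" using x \<open>0 \<le> t\<close> by (simp add: S_E R_mem_X R_T)
        finally show ?thesis .
      qed
    qed
  qed
  have "sobolev_tower sc X \<tau> \<Gamma> p T poly_mapping_scale (E 0) Y chain.\<tau> q S chain.D chain.A"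
    by (rule chain.sobolev_towerI[OF E_linear _ linear_homeomorphism.homeo[OF hom]])
      (simp_all add: Y_def q_E S_E)
  then show ?thesis by blast
qed

theorem theorem3p3:
  fixes smul :: "'k::real_normed_field \<Rightarrow> 'a::ab_group_add \<Rightarrow> 'a"
    and X0 :: "'a set" and \<tau>0 :: "'a topology"
    and \<Gamma> :: "'g set" and p0 :: "'g \<Rightarrow> 'a \<Rightarrow> real"
    and T0 :: "real \<Rightarrow> 'a \<Rightarrow> 'a"
    and D0 :: "'a set" and A0 :: "'a \<Rightarrow> 'a"
  assumes "vector_space smul"
    and "module.subspace smul X0"
    and "\<And>\<gamma>. \<gamma> \<in> \<Gamma> \<Longrightarrow> seminorm_on smul X0 (p0 \<gamma>)"
    and "\<tau>0 = seminorm_topology X0 (p0 ` \<Gamma>)"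
    and "Hausdorff_space \<tau>0"
    and "complete_tvs X0 \<tau>0"
    and "sc_ee_semigroup smul X0 \<tau>0 T0"
    and "D0 = generator_domain smul X0 \<tau>0 T0"
    and "A0 = generator smul \<tau>0 T0"
    and "bij_betw A0 D0 X0"
    and "continuous_map \<tau>0 \<tau>0 (inv_into D0 A0)"
  shows
    "(\<exists>(sc :: 'k \<Rightarrow> (nat \<times> 'a \<Rightarrow>\<^sub>0 'k) \<Rightarrow> (nat \<times> 'a \<Rightarrow>\<^sub>0 'k)) j X \<tau> p T D A.
        sobolev_tower smul X0 \<tau>0 \<Gamma> p0 T0 sc j X \<tau> p T D A)
     \<and>
     (\<forall>(sc :: 'k \<Rightarrow> 'b::ab_group_add \<Rightarrow> 'b) j X \<tau> p T D A.
        sobolev_tower smul X0 \<tau>0 \<Gamma> p0 T0 sc j X \<tau> p T D A \<longrightarrow>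
        \<comment> \<open>well-definedness\<close>
        (\<forall>n. locally_convex_space sc (X n) (\<tau> n) \<and> Hausdorff_space (\<tau> n) \<and> complete_tvs (X n) (\<tau> n)) \<and>
        (\<forall>n. (\<forall>\<gamma>\<in>\<Gamma>. seminorm_on sc (X n) (p n \<gamma>)) \<and> \<tau> n = seminorm_topology (X n) (p n ` \<Gamma>)) \<and>
        (\<forall>n\<le>-1. \<forall>\<gamma>\<in>\<Gamma>. unique_continuous_extension (\<tau> n) euclideanreal (X (n + 1))
           (\<lambda>x. p (n + 1) \<gamma> (inv_into (D (n + 1)) (A (n + 1)) x)) (p n \<gamma>)) \<and>
        (\<forall>n. bij_betw (A n) (D n) (X n)) \<and>
        \<comment> \<open>(i)\<close>
        (\<forall>n. X n \<subseteq> X (n - 1) \<and> \<tau> (n - 1) closure_of X n = X (n - 1) \<and>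
             continuous_map (\<tau> n) (\<tau> (n - 1)) (\<lambda>x. x)) \<and>
        \<comment> \<open>(ii)\<close>
        (\<forall>n\<le>0. \<tau> n = seminorm_topology (X n) ((\<lambda>\<gamma> x. p (n - 1) \<gamma> (A (n - 1) x)) ` \<Gamma>)) \<and>
        \<comment> \<open>(iii)\<close>
        (\<forall>n\<ge>0. is_completion sc (X (n + 1))
           (seminorm_topology (X (n + 1))
              ((\<lambda>\<gamma> x. p (n + 1) \<gamma> (inv_into (D (n + 1)) (A (n + 1)) x)) ` \<Gamma>))
           (X n) (\<tau> n)) \<and>
        (\<forall>n. sc_ee_semigroup sc (X n) (\<tau> n) (T n)) \<and>
        \<comment> \<open>(iv)\<close>
        (\<forall>n. \<forall>t\<ge>0. (\<forall>x\<in>X n. T n t x = T (n - 1) t x) \<and>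
             unique_continuous_extension (\<tau> n) (\<tau> n) (X (n + 1)) (T (n + 1) t) (T n t)) \<and>
        \<comment> \<open>(v)\<close>
        (\<forall>n. D n = X (n + 1) \<and>
             linear_map_on sc sc (X (n + 1)) (A n) \<and>
             homeomorphic_map (\<tau> (n + 1)) (\<tau> n) (A n) \<and>
             (\<forall>x\<in>X (n + 1). A n x = A (n - 1) x) \<and>
             unique_continuous_extension (\<tau> (n + 1)) (\<tau> n) (X (n + 2)) (A (n + 1)) (A n)))"
proof -
  have level: "sobolev_level smul X0 p0 \<Gamma> T0"
    unfolding sobolev_level_def lcs_def lcs_axioms_def sobolev_level_axioms_def
    using assms by auto
  show ?thesis
  proof (rule conjI, goal_cases)
    case 1
    show ?case
      unfolding assms(4) by (rule sobolev_level.exists_sobolev_tower[OF level])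
  next
    case 2
    show ?case
    proof (intro allI impI, goal_cases)
      case (1 sc j X \<tau> p T D A)
      note tower = 1
      interpret chain: sobolev_chain sc X p \<Gamma> T
        by (rule sobolev_tower_chain(1)[OF level assms(4) tower])
      \<comment> \<open>Once \<tau>, \<open>D\<close> and \<open>A\<close> are known to equal their
        counterparts in the chain as functions of the index, each claim becomes a fact about the
        chain.\<close>
      have \<tau>: "\<tau> = (\<lambda>n. chain.\<tau> n)"
        using sobolev_tower_chain(2)[OF level assms(4) tower] by (intro ext)
      have D: "D = (\<lambda>n. chain.D n)" and A: "A = (\<lambda>n. chain.A n)"
        using tower unfolding sobolev_tower_def \<tau> by auto
      show ?case
        unfolding \<tau> D A
        by (intro conjI allI impI ballI; rule chain.tower_levels chain.tower_seminorm_extension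
            chain.bij_generator chain.tower_inclusion chain.tower_topology_lower chain.tower_completion
            chain.tower_semigroup chain.D_eq chain.tower_generator refl; assumption)
    qed
  qed
qed

end
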